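(* Let $R:\Omega\to\Omega$ be a measurable map of a metric space $(\Omega,d_\Omega)$, let $\mu_\Omega$ be a probability measure on $\Omega$ that is invariant and ergodic under $R$, let $r:\Omega\to\mathbb{R}^+$ be a roof function with $\int_\Omega r\,d\mu_\Omega<\infty$, and let $X_t$ be the suspension flow over $R$ with roof function $r$ on the space $X$, with induced invariant probability measure $\mu_X$. Let $(x,s)\in X$, and for $\rho>0$ let $B^X_\rho(x,s)$ be the closed $\rho$-ball centered at $(x,s)$ in the box metric $d_X$, and let $B^\Omega_\rho(x)$ be the ball centered at $x$ with radius $\rho$ in $\Omega$. Then the following hold. 1. If the first hitting time distribution of $R$ is exponential, i.e. for every $t>0$ $$\mu_\Omega\left(\tau^R_{B^\Omega_\rho(x)}>\frac{t}{\mu_\Omega(B^\Omega_\rho(x))}\right)\to e^{-t}\quad\text{as }\rho\to0,$$ then for every $t>0$ $$\mu_X\left(\tau^X_{B^X_\rho(x,s)}>\frac{t\cdot 2\rho}{\mu_X(B^X_\rho(x,s))}\right)\to e^{-t}\quad\text{as }\rho\to0.$$ 2. If the higher order hitting times distribution of $R$ is Poisson, i.e. for every $t>0$ and every integer $m\ge1$ $$\mu_\Omega\left(\tau^{m,R}_{B^\Omega_\rho(x)}\le\frac{t}{\mu_\Omega(B^\Omega_\rho(x))}<\tau^{m+1,R}_{B^\Omega_\rho(x)}\right)\to e^{-t}\frac{t^m}{m!}\quad\text{as }\rho\to0,$$ then for every $t>0$ and every integer $m\ge1$ $$\mu_X\left(\tau^{m,X}_{B^X_\rho(x,s)}\le\frac{t\cdot2\rho}{\mu_X(B^X_\rho(x,s))}<\tau^{m+1,X}_{B^X_\rho(x,s)}\right)\to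 e^{-t}\frac{t^m}{m!}\quad\text{as }\rho\to0.$$
   Context: Suspension flow: $X=\Omega\times[0,\infty)/\!\sim$, where the equivalence relation is given by $(x,r(x))\sim(R(x),0)$, so that points of $X$ are represented by pairs $(x,u)$ with $0\le u<r(x)$; $X_t$ moves points upward at unit speed, $X_t(x,u)=(x,u+t)$ modulo the identification. Its invariant probability measure is $d\mu_X=\dfrac{d\mu_\Omega\times dt}{\int_\Omega r\,d\mu_\Omega}$. Box metric on $X$: $d_X((x,t_1),(y,t_2))=\max\{d_\Omega(x,y),|t_2-t_1|\}$. Hitting times for $R$: for $A\subset\Omega$, $\tau^R_A(x)=\tau^{1,R}_A(x)=\min\{k>0:R^k(x)\in A\}$ and, for $m\ge1$, $\tau^{m+1,R}_A(x)=\min\{k>\tau^{m,R}_A(x):R^k(x)\in A\}$. Hitting times for the flow: for $A\subset X$ the exit time is $E_A(x)=\inf\{t\ge0:X_t(x)\notin A\}$; the first hitting time is $\tau^X_A(x)=\tau^{1,X}_A(x)=\inf\{t>E_A(x):X_t(x)\in A\}$; and, for $m\ge1$, $\tau^{m+1,X}_A(x)=\inf\{t>\tau^{m,X}_A(x)+E_A(X_{\tau^{m,X}_A(x)}(x)):X_t(x)\in A\}$.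
   Formalization: The point (x,s) is assumed to be interior to X in Ω×ℝ (s>0 and r>s+δ near x for some δ>0), so that small balls are full boxes of height 2ρ; for s=0 and r=1 the limit would be e^{-2t}, and the claim can also fail where r is not lower semicontinuous at x. *)

theory Defs
  imports "HOL-Probability.Probability"
begin

definition ergodic_on :: "'a measure \<Rightarrow> ('a \<Rightarrow> 'a) \<Rightarrow> bool" where
  "ergodic_on M R \<longleftrightarrow>
     (\<forall>A\<in>sets M. R -` A \<inter> space M = A \<longrightarrow> measure M A = 0 \<or> measure M (space M - A) = 0)"

section \<open>The suspension flow\<close>

text \<open>The phase space is represented by the fundamental domain of the identification
  \<open>(x, r x) \<sim> (R x, 0)\<close>.\<close>

definition susp_space :: "('a \<Rightarrow> real) \<Rightarrow> ('a \<times> real) set" where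
  "susp_space r = {(x, u). 0 \<le> u \<and> u < r x}"

definition roof_sum :: "('a \<Rightarrow> 'a) \<Rightarrow> ('a \<Rightarrow> real) \<Rightarrow> nat \<Rightarrow> 'a \<Rightarrow> real" where
  "roof_sum R r n x = (\<Sum>i<n. r ((R ^^ i) x))"

text \<open>For \<open>v \<ge> 0\<close>, the point of \<open>susp_space r\<close> that is identified with \<open>(x, v)\<close>.  If the roof
  sums along the orbit of \<open>x\<close> are bounded by \<open>v\<close> there is no such point; the value is then some
  pair outside \<open>susp_space r\<close>.  For an integrable positive roof over a finite invariant measure
  this concerns only a null set of points \<open>x\<close>.\<close>

definition susp_rep :: "('a \<Rightarrow> 'a) \<Rightarrow> ('a \<Rightarrow> real) \<Rightarrow> 'a \<Rightarrow> real \<Rightarrow> 'a \<times> real" where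
  "susp_rep R r x v =
     (let n = (LEAST n. v < roof_sum R r (Suc n) x) in ((R ^^ n) x, v - roof_sum R r n x))"

definition susp_flow :: "('a \<Rightarrow> 'a) \<Rightarrow> ('a \<Rightarrow> real) \<Rightarrow> real \<Rightarrow> 'a \<times> real \<Rightarrow> 'a \<times> real" where
  "susp_flow R r t = (\<lambda>(x, u). susp_rep R r x (u + t))"

definition susp_measure :: "'a measure \<Rightarrow> ('a \<Rightarrow> real) \<Rightarrow> ('a \<times> real) measure" where
  "susp_measure M r =
     scale_measure (ennreal (1 / (\<integral>x. r x \<partial>M)))
       (restrict_space (M \<Otimes>\<^sub>M lborel) (susp_space r))"

definition box_dist :: "'a::metric_space \<times> real \<Rightarrow> 'a \<times> real \<Rightarrow> real" where
  "box_dist p q = max (dist (fst p) (fst q)) \<bar>snd q - snd p\<bar>"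

definition box_cball ::
    "('a::metric_space \<Rightarrow> real) \<Rightarrow> 'a \<times> real \<Rightarrow> real \<Rightarrow> ('a \<times> real) set" where
  "box_cball r p \<rho> = {q \<in> susp_space r. box_dist p q \<le> \<rho>}"

text \<open>If \<open>(x, s)\<close> is an interior point of \<open>susp_space r\<close> in the product topology, i.e. \<open>s > 0\<close> and
  \<open>r > s + \<delta>\<close> on a neighbourhood of \<open>x\<close> for some \<open>\<delta> > 0\<close>, then \<open>box_cball r (x, s) \<rho>\<close> is the full
  box \<open>cball x \<rho> \<times> {s - \<rho>..s + \<rho>}\<close> for small \<open>\<rho>\<close>, with vertical fibres of length \<open>2\<rho>\<close>.
  This fails at other points: for \<open>s = 0\<close> the fibres have length at most \<open>\<rho>\<close>, and if
  \<open>r y \<le> s - \<rho>\<close> the fibre over \<open>y\<close> is empty.\<close>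

section \<open>Hitting times\<close>

text \<open>The \<open>m\<close>-th hitting time; it is infinite if there are fewer than \<open>m\<close> hits (\<open>Inf {} = \<infinity>\<close>).
  Starting the recursion from \<open>0\<close> at \<open>m = 0\<close> makes the first hitting time an instance of the
  general step.\<close>

primrec map_hit :: "('a \<Rightarrow> 'a) \<Rightarrow> 'a set \<Rightarrow> nat \<Rightarrow> 'a \<Rightarrow> enat" where
  "map_hit R A 0 x = 0"
| "map_hit R A (Suc m) x = Inf {enat k | k. map_hit R A m x < enat k \<and> (R ^^ k) x \<in> A}"

definition exit_time :: "(real \<Rightarrow> 'b \<Rightarrow> 'b) \<Rightarrow> 'b set \<Rightarrow> 'b \<Rightarrow> ereal" where
  "exit_time F A z = Inf {ereal t | t. 0 \<le> t \<and> F t z \<notin> A}"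

text \<open>Since \<open>F 0 z = z\<close>, the case \<open>m = 1\<close> is \<open>inf {t > exit_time F A z. F t z \<in> A}\<close>.  If the
  \<open>m\<close>-th hitting time is infinite, so are all later ones.\<close>

primrec flow_hit :: "(real \<Rightarrow> 'b \<Rightarrow> 'b) \<Rightarrow> 'b set \<Rightarrow> nat \<Rightarrow> 'b \<Rightarrow> ereal" where
  "flow_hit F A 0 z = 0"
| "flow_hit F A (Suc m) z =
     Inf {ereal t | t. flow_hit F A m z
                         + exit_time F A (F (real_of_ereal (flow_hit F A m z)) z) < ereal t
                       \<and> F t z \<in> A}"

end

theory Submission
  imports Defs
begin

text \<open>
  Let \<open>rbar\<close> be the mean of the roof and \<open>A\<close> a small ball around \<open>x\<close> in the base.  Near an
  interior point of the phase space, the ball of the box metric is \<open>A \<times> {s - \<rho>..s + \<rho>}\<close> and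
  lies strictly between the base and the roof.  A flow line therefore enters it exactly once for each
  visit of its base orbit to \<open>A\<close>: if the \<open>m\<close>-th visit has index \<open>k\<close>, then the \<open>m\<close>-th hit
  of the line through \<open>(y, u)\<close>, with \<open>y\<close> outside \<open>A\<close>, occurs at the \<open>k\<close>-th roof sum of
  \<open>y\<close> plus \<open>s - \<rho> - u\<close>.  This is \<open>flow_hit_Suc\<close>, which covers all starting points.
  By Birkhoff's theorem the \<open>k\<close>-th roof sum is about \<open>k * rbar\<close>, and \<open>rbar\<close> is also the
  ratio of the two time scales in the theorem.

  Two points need an argument.

  The first is that Birkhoff's theorem speaks about fixed indices whereas \<open>k\<close> is random.  Let
  \<open>c = t / \<mu>(A)\<close>.  By monotonicity of the roof sums it is enough to know them at the indices
  \<open>(1 - e) c\<close> and \<open>(1 + e) c\<close>, provided that there is no visit between these.  A visit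
  there has probability at most about \<open>2 e c \<mu>(A) = 2 e t\<close>, which is small with \<open>e\<close>
  (\<open>flow_event_iff\<close>, \<open>flow_event_measure_bound\<close>).  The form of Birkhoff's theorem
  that is needed, \<open>AE_roof_sum_near_mean\<close>, follows from a short maximal argument,
  \<open>roof_sum_bdd_above\<close>.

  The second is that the law is assumed for the measure of the base, while the starting point
  of a random flow line has a base point with density \<open>r / rbar\<close>.  Now the number of visits up to
  time \<open>c\<close> is almost invariant under the map: it changes in one step only if there is a visit
  at the first or just after the last index, an event of probability at most \<open>2 \<mu>(A)\<close>.  For an
  ergodic map the probabilities of asymptotically invariant events do not depend on the density in
  the limit (\<open>density_asymptotically_invariant\<close>, \<open>visits_law_transfer\<close>).

  Both points use that the measure of \<open>A\<close> is positive and tends to \<open>0\<close>, which the assumed law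
  implies (\<open>balls_shrink_of_law\<close>).
\<close>

section \<open>Visits of the map\<close>

definition visits :: "('a \<Rightarrow> 'a) \<Rightarrow> 'a set \<Rightarrow> nat \<Rightarrow> 'a \<Rightarrow> nat" where
  "visits R A n y = (\<Sum>k=1..n. of_bool ((R ^^ k) y \<in> A))"

lemma visits_0 [simp]: "visits R A 0 y = 0"
  by (simp add: visits_def)

lemma visits_Suc: "visits R A (Suc n) y = visits R A n y + of_bool ((R ^^ Suc n) y \<in> A)"
  by (simp add: visits_def)

lemma visits_mono: "n \<le> n' \<Longrightarrow> visits R A n y \<le> visits R A n' y"
  unfolding visits_def by (intro sum_mono2) auto

lemma visits_add: "visits R A (j + n) y = visits R A j y + visits R A n ((R ^^ j) y)"
proof (induction n)
  case (Suc n)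
  have "(R ^^ Suc (j + n)) y = (R ^^ Suc n) ((R ^^ j) y)"
    using funpow_add[of "Suc n" j R] by (simp add: add.commute)
  with Suc show ?case by (simp only: add_Suc_right visits_Suc)
qed simp

text \<open>A visit count over a time window changes under the map only through visits that leave the window at
its start or enter it at its end.  This is what makes the events \<open>visits R A n = m\<close> almost
invariant when \<open>A\<close> is small.\<close>

lemma visits_shift:
  assumes "visits R A j y = 0" "visits R A (n + j) y = visits R A n y"
  shows "visits R A n ((R ^^ j) y) = visits R A n y"
  using visits_add[of R A j n y] assms by (simp add: add.commute)

lemma Inf_enat_le_iff: "Inf S \<le> enat n \<longleftrightarrow> (\<exists>k\<in>S. k \<le> enat n)"
proof
  assume le: "Inf S \<le> enat n"
  then have "S \<noteq> {}" by (auto simp: Inf_enat_def)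
  then have "Inf S \<in> S" by (metis wellorder_InfI ex_in_conv)
  with le show "\<exists>k\<in>S. k \<le> enat n" by blast
qed (meson Inf_lower order_trans)

text \<open>Counting visits replaces the recursion for hitting times by a monotone function of time, which is
easier to compare across different times and to prove measurable.\<close>

lemma map_hit_le_iff: "map_hit R A m y \<le> enat n \<longleftrightarrow> m \<le> visits R A n y"
proof (induction m arbitrary: n)
  case 0
  then show ?case by (simp add: zero_enat_def)
next
  case (Suc m)
  have less: "map_hit R A m y < enat k \<longleftrightarrow> (\<exists>j. k = Suc j \<and> m \<le> visits R A j y)" for k
  proof (cases k)
    case 0
    then show ?thesis by (simp add: zero_enat_def[symmetric])
  next
    case (Suc j)
    have "map_hit R A m y < enat k \<longleftrightarrow> map_hit R A m y \<le> enat j"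
      unfolding Suc by (cases "map_hit R A m y") auto
    then show ?thesis using Suc Suc.IH by simp
  qed
  have "map_hit R A (Suc m) y \<le> enat n \<longleftrightarrow>
      (\<exists>j. Suc j \<le> n \<and> m \<le> visits R A j y \<and> (R ^^ Suc j) y \<in> A)"
  proof -
    have "map_hit R A (Suc m) y \<le> enat n \<longleftrightarrow>
        (\<exists>k. map_hit R A m y < enat k \<and> (R ^^ k) y \<in> A \<and> k \<le> n)"
      unfolding map_hit.simps Inf_enat_le_iff by (simp only: mem_Collect_eq Bex_def) force
    then show ?thesis unfolding less by metis
  qed
  also have "\<dots> \<longleftrightarrow> Suc m \<le> visits R A n y"
  proof
    assume "\<exists>j. Suc j \<le> n \<and> m \<le> visits R A j y \<and> (R ^^ Suc j) y \<in> A"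
    then obtain j where j: "Suc j \<le> n" "m \<le> visits R A j y" "(R ^^ Suc j) y \<in> A" by blast
    then have "Suc m \<le> visits R A (Suc j) y" by (simp add: visits_Suc)
    then show "Suc m \<le> visits R A n y" using visits_mono[OF j(1)] by (rule le_trans)
  next
    assume n: "Suc m \<le> visits R A n y"
    define k where "k = (LEAST k. Suc m \<le> visits R A k y)"
    have k: "Suc m \<le> visits R A k y" "k \<le> n"
      unfolding k_def using n by (rule LeastI, rule Least_le)
    then obtain j where kj: "k = Suc j" by (cases k) auto
    have "\<not> Suc m \<le> visits R A j y"
      using not_less_Least[of j "\<lambda>k. Suc m \<le> visits R A k y"] kj unfolding k_def by simp
    with k have "Suc j \<le> n \<and> m \<le> visits R A j y \<and> (R ^^ Suc j) y \<in> A"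
      unfolding kj visits_Suc by (cases "(R ^^ Suc j) y \<in> A") simp_all
    then show "\<exists>j. Suc j \<le> n \<and> m \<le> visits R A j y \<and> (R ^^ Suc j) y \<in> A" by blast
  qed
  finally show ?case .
qed

lemma map_hit_le_real_iff:
  assumes "0 \<le> c"
  shows "ereal_of_enat (map_hit R A m y) \<le> ereal c \<longleftrightarrow> m \<le> visits R A (nat \<lfloor>c\<rfloor>) y"
proof -
  have "ereal_of_enat (map_hit R A m y) \<le> ereal c \<longleftrightarrow> map_hit R A m y \<le> enat (nat \<lfloor>c\<rfloor>)"
    using assms by (cases "map_hit R A m y") (auto simp: le_nat_floor le_nat_iff le_floor_iff)
  then show ?thesis by (simp add: map_hit_le_iff)
qed

text \<open>For \<open>m = 0\<close> the lower bound holds trivially, so the event on the left is that the first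
hitting time exceeds \<open>c\<close>.  The first hitting time and the higher order ones can therefore be
treated by the same argument.\<close>

lemma map_hit_between_iff:
  assumes "0 \<le> c"
  shows "ereal_of_enat (map_hit R A m y) \<le> ereal c \<and> ereal c < ereal_of_enat (map_hit R A (m + 1) y)
    \<longleftrightarrow> visits R A (nat \<lfloor>c\<rfloor>) y = m"
  unfolding not_le[symmetric] map_hit_le_real_iff[OF assms] by auto

lemma map_hit_SucD:
  assumes "map_hit R A (Suc m) y = enat k"
  shows "(R ^^ k) y \<in> A"
proof -
  have "Inf {enat k | k. map_hit R A m y < enat k \<and> (R ^^ k) y \<in> A}
     \<in> {enat k | k. map_hit R A m y < enat k \<and> (R ^^ k) y \<in> A}"
    by (rule wellorder_InfI[of "SOME z. z \<in> _"], rule someI_ex)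
       (use assms in \<open>auto simp: Inf_enat_def ex_in_conv split: if_splits\<close>)
  then show ?thesis using assms by simp
qed

section \<open>Entries of the flow into a box below the roof\<close>

lemma roof_sum_0 [simp]: "roof_sum R r 0 y = 0"
  by (simp add: roof_sum_def)

lemma roof_sum_Suc: "roof_sum R r (Suc n) y = roof_sum R r n y + r ((R ^^ n) y)"
  by (simp add: roof_sum_def)

lemma roof_sum_mono:
  assumes "\<And>y. 0 < r y" "m \<le> n"
  shows "roof_sum R r m y \<le> roof_sum R r n y"
  using assms by (auto simp: roof_sum_def less_imp_le intro!: sum_mono2)

lemma susp_rep_eqI:
  assumes r: "\<And>y. 0 < r y" and n: "roof_sum R r n y \<le> v" "v < roof_sum R r (Suc n) y"
  shows "susp_rep R r y v = ((R ^^ n) y, v - roof_sum R r n y)"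
proof -
  have "(LEAST n. v < roof_sum R r (Suc n) y) = n"
  proof (rule Least_equality)
    fix i assume i: "v < roof_sum R r (Suc i) y"
    show "n \<le> i"
    proof (rule ccontr)
      assume "\<not> n \<le> i"
      then have "roof_sum R r (Suc i) y \<le> roof_sum R r n y" by (intro roof_sum_mono r) auto
      with i n show False by simp
    qed
  qed (use n in simp)
  then show ?thesis by (simp add: susp_rep_def Let_def)
qed

text \<open>Where the roof sums stay bounded by \<open>v\<close>, the value of \<^const>\<open>susp_rep\<close> is a point at or above
the roof.  Hence a flow line that is not properly defined at some time is outside every subset of the
phase space at that time, and the exact formulas for the hitting times below hold for all points, not
only almost everywhere.\<close>

lemma susp_rep_in_space:
  assumes r: "\<And>y. 0 < r y" and "0 \<le> v" "susp_rep R r y v \<in> susp_space r"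
  obtains n where "roof_sum R r n y \<le> v" "v < roof_sum R r (Suc n) y"
proof -
  define n where "n = (LEAST n. v < roof_sum R r (Suc n) y)"
  have rep: "susp_rep R r y v = ((R ^^ n) y, v - roof_sum R r n y)"
    by (simp add: susp_rep_def n_def Let_def)
  then show ?thesis using assms(3) by (intro that[of n]) (auto simp: susp_space_def roof_sum_Suc)
qed

text \<open>A box \<open>A \<times> {a..b}\<close> that stays strictly below the roof.  Every visit of the base orbit to
\<open>A\<close> then makes the flow line spend a full time interval of length \<open>b - a\<close> in the box, and
intervals for different visits are separated by a gap.\<close>

locale roof_box =
  fixes R :: "'a \<Rightarrow> 'a" and r :: "'a \<Rightarrow> real" and A :: "'a set" and a b :: real
  assumes r_pos: "\<And>y. 0 < r y"
    and a_nonneg: "0 \<le> a" and a_less_b: "a < b"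
    and b_less_roof: "\<And>y. y \<in> A \<Longrightarrow> b < r y"
begin

abbreviation "S \<equiv> roof_sum R r"
abbreviation "F \<equiv> susp_flow R r"
abbreviation "B \<equiv> A \<times> {a..b}"

lemma box_subset: "B \<subseteq> susp_space r"
  using a_nonneg b_less_roof by (force simp: susp_space_def)

lemma flow_at_height:
  assumes "u + t = S k y + v" "0 \<le> v" "v < r ((R ^^ k) y)"
  shows "F t (y, u) = ((R ^^ k) y, v)"
proof -
  have "susp_rep R r y (u + t) = ((R ^^ k) y, u + t - S k y)"
    by (rule susp_rep_eqI[OF r_pos]) (use assms in \<open>simp_all add: roof_sum_Suc\<close>)
  then show ?thesis using assms by (simp add: susp_flow_def)
qed

lemma flow_in_box_iff:
  assumes "0 \<le> u + t"
  shows "F t (y, u) \<in> B \<longleftrightarrow> (\<exists>k. (R ^^ k) y \<in> A \<and> S k y + a \<le> u + t \<and> u + t \<le> S k y + b)"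
proof
  assume F: "F t (y, u) \<in> B"
  then have "susp_rep R r y (u + t) \<in> susp_space r" using box_subset by (auto simp: susp_flow_def)
  then obtain n where n: "S n y \<le> u + t" "u + t < S (Suc n) y"
    by (rule susp_rep_in_space[where r = r, OF r_pos assms])
  show "\<exists>k. (R ^^ k) y \<in> A \<and> S k y + a \<le> u + t \<and> u + t \<le> S k y + b"
    using F susp_rep_eqI[where r = r, OF r_pos n] by (intro exI[of _ n]) (auto simp: susp_flow_def)
next
  assume "\<exists>k. (R ^^ k) y \<in> A \<and> S k y + a \<le> u + t \<and> u + t \<le> S k y + b"
  then obtain k where k: "(R ^^ k) y \<in> A" "S k y + a \<le> u + t" "u + t \<le> S k y + b" by blast
  then have "F t (y, u) = ((R ^^ k) y, u + t - S k y)"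
    using a_nonneg b_less_roof[OF k(1)] by (intro flow_at_height) auto
  then show "F t (y, u) \<in> B" using k by auto
qed

text \<open>The box is closed, so the exit time is approached from above through points between the box and the
roof.\<close>

lemma exit_time_inside:
  assumes "w \<in> A" "a \<le> v" "v \<le> b"
  shows "exit_time F B (w, v) = ereal (b - v)"
proof -
  have F: "F t (w, v) = (w, v + t)" if "0 \<le> t" "v + t < r w" for t
    using that assms a_nonneg flow_at_height[of v t 0 w "v + t"] by simp
  show ?thesis unfolding exit_time_def
  proof (rule Inf_eqI)
    fix i assume "i \<in> {ereal t |t. 0 \<le> t \<and> F t (w, v) \<notin> B}"
    then obtain t where t: "i = ereal t" "0 \<le> t" "F t (w, v) \<notin> B" by blast
    then show "ereal (b - v) \<le> i"
      using F[of t] assms b_less_roof[OF assms(1)] by (cases "t \<le> b - v") auto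
  next
    fix l assume l: "\<And>i. i \<in> {ereal t |t. 0 \<le> t \<and> F t (w, v) \<notin> B} \<Longrightarrow> l \<le> i"
    have le: "l \<le> ereal t" if "b - v < t" "t < r w - v" for t
      using that assms F[of t] by (intro l) auto
    show "l \<le> ereal (b - v)"
    \<comment> \<open>only times at which the flow line is still below the roof are needed\<close>
    proof (rule dense_ge_bounded)
      show "ereal (b - v) < ereal (r w - v)" using b_less_roof[OF assms(1)] by simp
      show "l \<le> t" if "ereal (b - v) < t" "t < ereal (r w - v)" for t
        using that le[of "real_of_ereal t"] by (cases t) auto
    qed
  qed
qed

lemma exit_time_outside:
  assumes "(w, v) \<in> susp_space r" "(w, v) \<notin> B"
  shows "exit_time F B (w, v) = 0"
proof -
  have "F 0 (w, v) = (w, v)"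
    using assms(1) flow_at_height[of v 0 0 w v] by (simp add: susp_space_def)
  then show ?thesis
    unfolding exit_time_def using assms(2)
    by (intro Inf_eqI) (auto simp: zero_ereal_def)
qed

text \<open>The time at which the flow line through \<open>(y, u)\<close> reaches height \<open>a\<close> above the
\<open>k\<close>-th point of the base orbit.  The base index is an extended natural number so that
\<^const>\<open>map_hit\<close> can be inserted directly.\<close>

definition entry_time :: "'a \<Rightarrow> real \<Rightarrow> enat \<Rightarrow> ereal" where
  "entry_time y u k = (case k of enat k \<Rightarrow> ereal (S k y + a - u) | \<infinity> \<Rightarrow> \<infinity>)"

lemma Inf_box_times:
  "Inf {ereal t | t. \<exists>i\<in>K. S i y + a \<le> u + t \<and> u + t \<le> S i y + b}
    = entry_time y u (Inf (enat ` K))"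
proof (cases "K = {}")
  case True
  then show ?thesis by (simp add: entry_time_def Inf_enat_def top_ereal_def)
next
  case False
  define k where "k = (LEAST i. i \<in> K)"
  have k: "k \<in> K" "\<And>i. i \<in> K \<Longrightarrow> k \<le> i"
    unfolding k_def using False by (auto intro: LeastI Least_le)
  have "Inf (enat ` K) = enat k"
    using k by (intro Inf_eqI) auto
  moreover have "Inf {ereal t | t. \<exists>i\<in>K. S i y + a \<le> u + t \<and> u + t \<le> S i y + b} = ereal (S k y + a - u)"
  proof (rule Inf_eqI)
    fix i assume "i \<in> {ereal t | t. \<exists>i\<in>K. S i y + a \<le> u + t \<and> u + t \<le> S i y + b}"
    then obtain t j where "i = ereal t" "j \<in> K" "S j y + a \<le> u + t" by blast
    then show "ereal (S k y + a - u) \<le> i"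
      using roof_sum_mono[of r k j R y] r_pos k(2)[of j] by auto
  next
    fix l assume "\<And>i. i \<in> {ereal t | t. \<exists>i\<in>K. S i y + a \<le> u + t \<and> u + t \<le> S i y + b} \<Longrightarrow> l \<le> i"
    then show "l \<le> ereal (S k y + a - u)" using k(1) a_less_b by force
  qed
  ultimately show ?thesis by (simp add: entry_time_def)
qed

text \<open>The index set \<open>K\<close> separates the visits whose time interval lies after \<open>e\<close> from those
whose interval is already over at time \<open>e\<close>; no interval may be cut by \<open>e\<close> in the middle.
Both the start of the flow and the exit times after earlier hits have this property.\<close>

lemma box_times_after:
  assumes "0 \<le> e" "0 \<le> u"
    and "\<And>i. (R ^^ i) y \<in> A \<Longrightarrow> i \<in> K \<Longrightarrow> u + e < S i y + a"
    and "\<And>i. (R ^^ i) y \<in> A \<Longrightarrow> i \<notin> K \<Longrightarrow> S i y + b \<le> u + e"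
  shows "Inf {ereal t | t. ereal e < ereal t \<and> F t (y, u) \<in> B}
    = entry_time y u (Inf {enat k | k. k \<in> K \<and> (R ^^ k) y \<in> A})"
proof -
  have "ereal e < ereal t \<and> F t (y, u) \<in> B \<longleftrightarrow>
     (\<exists>i\<in>{k \<in> K. (R ^^ k) y \<in> A}. S i y + a \<le> u + t \<and> u + t \<le> S i y + b)" (is "?l \<longleftrightarrow> ?r") for t
  proof
    assume l: ?l
    with assms flow_in_box_iff[of u t y]
    obtain k where k: "(R ^^ k) y \<in> A" "S k y + a \<le> u + t" "u + t \<le> S k y + b" by auto
    then have "k \<in> K" using assms(4)[of k] l by force
    with k show ?r by auto
  next
    assume ?r
    then obtain k where k: "k \<in> K" "(R ^^ k) y \<in> A" "S k y + a \<le> u + t" "u + t \<le> S k y + b" by auto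
    with assms(3)[of k] have "e < t" by simp
    with k assms flow_in_box_iff[of u t y] show ?l by auto
  qed
  then have "{ereal t | t. ereal e < ereal t \<and> F t (y, u) \<in> B} =
    {ereal t | t. \<exists>i\<in>{k \<in> K. (R ^^ k) y \<in> A}. S i y + a \<le> u + t \<and> u + t \<le> S i y + b}" by simp
  moreover have "enat ` {k \<in> K. (R ^^ k) y \<in> A} = {enat k | k. k \<in> K \<and> (R ^^ k) y \<in> A}" by auto
  ultimately show ?thesis using Inf_box_times[of "{k \<in> K. (R ^^ k) y \<in> A}" y u] by simp
qed

lemma next_roof_above_box:
  assumes "(R ^^ k) y \<in> A" "k < i"
  shows "S k y + b < S i y + a"
  using roof_sum_mono[of r "Suc k" i R y] r_pos b_less_roof[OF assms(1)] assms(2) a_nonneg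
  by (simp add: roof_sum_Suc)

text \<open>Time \<open>0\<close> is no hitting time of the map, but the visit of the base orbit at index \<open>0\<close>
does give a hit of the flow if the starting point lies above \<open>A\<close> and below the box.  In that
case the hits of the flow are shifted by one against those of the map.\<close>

definition first_index :: "'a \<Rightarrow> real \<Rightarrow> nat" where
  "first_index y u = (if y \<in> A \<and> u < a then 0 else 1)"

lemma flow_hit_1:
  assumes z: "(y, u) \<in> susp_space r"
  shows "flow_hit F B 1 (y, u) = entry_time y u (map_hit R A (first_index y u) y)"
proof -
  have u: "0 \<le> u" "u < r y" using z by (auto simp: susp_space_def)
  have F0: "F 0 (y, u) = (y, u)"
    using u flow_at_height[of u 0 0 y u] by simp
  have S1: "r y \<le> S i y" if "1 \<le> i" for i
    using roof_sum_mono[of r 1 i R y] r_pos that by (simp add: roof_sum_def)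
  have step: "flow_hit F B 1 (y, u) = Inf {ereal t | t. exit_time F B (y, u) < ereal t \<and> F t (y, u) \<in> B}"
    by (simp add: F0 zero_ereal_def[symmetric])
  have one: "entry_time y u (Inf {enat k | k. k \<in> {1..} \<and> (R ^^ k) y \<in> A}) =
     entry_time y u (map_hit R A 1 y)"
    by (rule arg_cong[where f = "entry_time y u"])
       (auto simp: zero_enat_def Suc_le_eq)
  consider "y \<in> A" "u < a" | "y \<in> A" "a \<le> u" "u \<le> b" | "(y, u) \<notin> B" "y \<in> A \<longrightarrow> b < u"
    by fastforce
  then show ?thesis
  proof cases
    \<comment> \<open>below the box: the first entry belongs to base index 0\<close>
    case 1
    have "exit_time F B (y, u) = ereal 0"
      using 1 z exit_time_outside by (simp add: zero_ereal_def)
    moreover have "Inf {enat k | k. k \<in> UNIV \<and> (R ^^ k) y \<in> A} \<le> enat 0"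
      using 1 by (intro Inf_lower) (auto intro!: exI[of _ 0])
    then have "Inf {enat k | k. k \<in> UNIV \<and> (R ^^ k) y \<in> A} = enat 0"
      by (simp add: zero_enat_def[symmetric])
    moreover have "u + 0 < S i y + a" for i
      using 1 roof_sum_mono[of r 0 i R y] r_pos by simp
    ultimately show ?thesis
      unfolding step using box_times_after[of 0 u y UNIV] u 1
      by (simp add: first_index_def zero_enat_def)
  next
    \<comment> \<open>inside the box: the flow first has to leave it\<close>
    case 2
    have "exit_time F B (y, u) = ereal (b - u)" using 2 exit_time_inside by simp
    moreover have "u + (b - u) < S i y + a" if "i \<in> {1..}" for i
      using S1[of i] that b_less_roof[of y] 2 a_nonneg by simp
    moreover have "S i y + b \<le> u + (b - u)" if "i \<notin> {1..}" for i
      using that by (simp add: Suc_le_eq)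
    ultimately show ?thesis
      unfolding step using box_times_after[of "b - u" u y "{1..}"] u 2 one
      by (simp add: first_index_def)
  next
    \<comment> \<open>not over the base of the box, or above it\<close>
    case 3
    have "exit_time F B (y, u) = ereal 0"
      using 3 z exit_time_outside by (simp add: zero_ereal_def)
    moreover have "u + 0 < S i y + a" if "i \<in> {1..}" for i
      using S1[of i] that u a_nonneg by simp
    moreover have "S i y + b \<le> u + 0" if "(R ^^ i) y \<in> A" "i \<notin> {1..}" for i
      using that 3 by (simp add: Suc_le_eq)
    moreover have "first_index y u = 1" using 3 a_less_b by (auto simp: first_index_def)
    ultimately show ?thesis
      unfolding step using box_times_after[of 0 u y "{1..}"] u one by simp
  qed
qed

text \<open>After an entry the flow is at the bottom of the box, so the exit time is exactly \<open>b - a\<close>, and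
the next entry belongs to the next visit of the base orbit.\<close>

lemma flow_hit_Suc:
  assumes z: "(y, u) \<in> susp_space r"
  shows "flow_hit F B (Suc m) (y, u) = entry_time y u (map_hit R A (m + first_index y u) y)"
proof (induction m)
  case 0
  then show ?case using flow_hit_1[OF z] by simp
next
  case (Suc m)
  let ?j = "m + first_index y u"
  have u: "0 \<le> u" using z by (auto simp: susp_space_def)
  show ?case
  proof (cases "map_hit R A ?j y")
    case infinity
    then have "flow_hit F B (Suc m) (y, u) = \<infinity>" using Suc by (simp add: entry_time_def)
    then have "flow_hit F B (Suc (Suc m)) (y, u) = \<infinity>"
      by (subst flow_hit.simps) (simp add: top_ereal_def)
    moreover have "map_hit R A (Suc ?j) y = \<infinity>" using infinity by (simp add: Inf_enat_def)
    ultimately show ?thesis by (simp add: entry_time_def)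
  next
    case (enat k)
    have k: "(R ^^ k) y \<in> A" "u \<le> S k y + a"
    proof -
      have "(R ^^ k) y \<in> A \<and> (k = 0 \<longrightarrow> u < a)"
      proof (cases "?j")
        case 0
        then show ?thesis using enat by (auto simp: first_index_def zero_enat_def split: if_splits)
      next
        case (Suc j')
        then have "\<not> map_hit R A ?j y \<le> enat 0" unfolding map_hit_le_iff by simp
        then show ?thesis using enat map_hit_SucD[of R A j' y k] Suc by auto
      qed
      moreover have "r y \<le> S k y" if "k \<noteq> 0"
        using roof_sum_mono[of r 1 k R y] r_pos that by (simp add: roof_sum_def)
      ultimately show "(R ^^ k) y \<in> A" "u \<le> S k y + a"
        using z a_nonneg by (auto simp: susp_space_def) (cases "k = 0"; force)
    qed
    let ?h = "S k y + a - u"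
    have h: "flow_hit F B (Suc m) (y, u) = ereal ?h" using Suc enat by (simp add: entry_time_def)
    have Fh: "F ?h (y, u) = ((R ^^ k) y, a)"
      using b_less_roof[OF k(1)] a_less_b a_nonneg by (intro flow_at_height) auto
    have "flow_hit F B (Suc (Suc m)) (y, u) =
      Inf {ereal t | t. ereal (?h + (b - a)) < ereal t \<and> F t (y, u) \<in> B}"
    proof -
      have "exit_time F B (F ?h (y, u)) = ereal (b - a)"
        unfolding Fh using exit_time_inside[OF k(1)] a_less_b by simp
      then show ?thesis
        unfolding flow_hit.simps(2)[of F B "Suc m"] h real_of_ereal.simps
        by (simp only: plus_ereal.simps)
    qed
    also have "\<dots> = entry_time y u (Inf {enat i | i. i \<in> {k<..} \<and> (R ^^ i) y \<in> A})"
    proof (rule box_times_after)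
      fix i assume i: "(R ^^ i) y \<in> A" "i \<notin> {k<..}"
      then show "S i y + b \<le> u + (?h + (b - a))"
        using roof_sum_mono[of r i k R y] r_pos by simp
    qed (use k u a_less_b next_roof_above_box[OF k(1)] in auto)
    also have "{enat i | i. i \<in> {k<..} \<and> (R ^^ i) y \<in> A} =
       {enat i | i. map_hit R A ?j y < enat i \<and> (R ^^ i) y \<in> A}"
      using enat by auto
    finally show ?thesis by simp
  qed
qed

text \<open>Roof sums increase, so \<open>k\<close> need not be the hitting time itself but may be any later
index whose shifted roof sum is at most \<open>c\<close>.\<close>

lemma flow_hit_le_iff:
  assumes z: "(y, u) \<in> susp_space r"
  shows "flow_hit F B (Suc m) (y, u) \<le> ereal c \<longleftrightarrow>
    (\<exists>k. m + first_index y u \<le> visits R A k y \<and> S k y + a - u \<le> c)"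
proof -
  have "entry_time y u n \<le> ereal c \<longleftrightarrow> (\<exists>k. n \<le> enat k \<and> S k y + a - u \<le> c)" for n
  proof (cases n)
    case (enat i)
    have "S i y + a - u \<le> c" if "i \<le> k" "S k y + a - u \<le> c" for k
      using roof_sum_mono[of r i k R y] r_pos that by simp
    then show ?thesis using enat by (auto simp: entry_time_def)
  qed (simp add: entry_time_def)
  then show ?thesis unfolding flow_hit_Suc[OF z] map_hit_le_iff[symmetric] .
qed

lemma flow_hit_Suc_le_iff:
  assumes "z \<in> susp_space r"
  shows "flow_hit F B (Suc m) z \<le> ereal c \<longleftrightarrow>
    (\<exists>k. (if fst z \<in> A \<and> snd z < a then m \<le> visits R A k (fst z) else Suc m \<le> visits R A k (fst z))
      \<and> S k (fst z) + a - snd z \<le> c)"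
proof -
  have "flow_hit F B (Suc m) (fst z, snd z) \<le> ereal c \<longleftrightarrow>
      (\<exists>k. m + first_index (fst z) (snd z) \<le> visits R A k (fst z) \<and> S k (fst z) + a - snd z \<le> c)"
    using assms by (intro flow_hit_le_iff) simp
  then show ?thesis
    unfolding prod.collapse first_index_def
    by (cases "fst z \<in> A \<and> snd z < a") (simp_all only: if_True if_False simp_thms add_0_right add_Suc_right One_nat_def)
qed

text \<open>If the base orbit makes no visit between the indices \<open>L\<close> and \<open>H\<close>, then comparing the roof
sums at these two deterministic indices with \<open>c\<close> suffices to compare the hitting times.\<close>

lemma flow_hit_le_iff_visits:
  assumes z: "(y, u) \<in> susp_space r" "y \<notin> A" and c: "0 \<le> c"
    and LH: "L \<le> N" "N \<le> H" "visits R A H y = visits R A L y"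
    and LH_time: "S L y + a - u \<le> c" "c < S H y + a - u"
  shows "flow_hit F B m (y, u) \<le> ereal c \<longleftrightarrow> m \<le> visits R A N y"
proof (cases m)
  case 0
  then show ?thesis using c by simp
next
  case (Suc m')
  have mid: "visits R A N y = visits R A L y"
    using LH visits_mono[of L N R A y] visits_mono[of N H R A y] by simp
  have "flow_hit F B m (y, u) \<le> ereal c \<longleftrightarrow> (\<exists>k. m \<le> visits R A k y \<and> S k y + a - u \<le> c)"
    using flow_hit_le_iff[OF z(1), of m'] z(2) by (simp add: first_index_def Suc)
  also have "\<dots> \<longleftrightarrow> m \<le> visits R A N y"
  proof
    assume "\<exists>k. m \<le> visits R A k y \<and> S k y + a - u \<le> c"
    then obtain k where k: "m \<le> visits R A k y" "S k y + a - u \<le> c" by blast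
    have "k < H"
      using roof_sum_mono[of r H k R y] r_pos k(2) LH_time(2) by (cases "k < H") auto
    then show "m \<le> visits R A N y" using visits_mono[of k H R A y] k(1) mid LH(3) by simp
  next
    assume "m \<le> visits R A N y"
    then show "\<exists>k. m \<le> visits R A k y \<and> S k y + a - u \<le> c" using mid LH_time(1) by auto
  qed
  finally show ?thesis .
qed

end

section \<open>Birkhoff sums of an ergodic map\<close>

locale measure_preserving_map = prob_space M for M :: "'a measure" +
  fixes R :: "'a \<Rightarrow> 'a"
  assumes R_measurable [measurable]: "R \<in> measurable M M"
    and distr_R: "distr M M R = M"
begin

lemma funpow_measurable [measurable]: "(R ^^ n) \<in> measurable M M"
  by (induction n) (simp_all add: comp_def measurable_ident_sets[of M M] cong: measurable_cong_simp)

lemma distr_funpow: "distr M M (R ^^ n) = M"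
proof (induction n)
  case 0
  then show ?case using distr_id[of M] by (simp add: id_def)
next
  case (Suc n)
  have "distr M M (R ^^ Suc n) = distr (distr M M (R ^^ n)) M R"
    by (subst distr_distr) auto
  then show ?case unfolding Suc distr_R .
qed

lemma integrable_funpow [intro]:
  assumes "integrable M (f :: 'a \<Rightarrow> real)"
  shows "integrable M (\<lambda>y. f ((R ^^ n) y))"
  using assms distr_funpow[of n] by (metis integrable_distr funpow_measurable)

lemma integral_funpow:
  assumes [measurable]: "f \<in> borel_measurable M"
  shows "(\<integral>y. f ((R ^^ n) y) \<partial>M) = (\<integral>y. f y \<partial>M :: real)"
  using integral_distr[of "R ^^ n" M M f] by (simp add: distr_funpow)

lemma measure_funpow:
  assumes "E \<in> sets M"
  shows "measure M ((R ^^ n) -` E \<inter> space M) = measure M E"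
  using measure_distr[of "R ^^ n" M M E] assms by (simp add: distr_funpow)

lemma roof_sum_measurable [measurable]:
  assumes [measurable]: "f \<in> borel_measurable M"
  shows "roof_sum R f n \<in> borel_measurable M"
  unfolding roof_sum_def by measurable

end

locale ergodic_map = measure_preserving_map +
  assumes ergodic: "ergodic_on M R"
begin

text \<open>The function \<open>X n\<close> of the proof is the maximum of the first \<open>n\<close> Birkhoff sums and
\<open>0\<close>; it satisfies \<open>X (n + 1) = max 0 (f + X n \<circ> R)\<close>.  The set where \<open>X n\<close> is unbounded is invariant.  If it had full measure, then
\<open>X (n + 1) - X n \<circ> R\<close> would tend to \<open>f\<close>, dominated by \<open>\<bar>f\<bar>\<close>.  But its integral is
nonnegative, since \<open>R\<close> preserves the measure and \<open>X\<close> increases, and this contradicts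
the negative mean of \<open>f\<close>.  So by ergodicity the sums are bounded almost everywhere.\<close>

lemma roof_sum_bdd_above:
  fixes f :: "'a \<Rightarrow> real"
  assumes f: "integrable M f" and neg: "(\<integral>y. f y \<partial>M) < 0"
  shows "AE y in M. \<exists>K. \<forall>n. roof_sum R f n y \<le> K"
proof -
  have [measurable]: "f \<in> borel_measurable M" using f by auto
  define X where "X = rec_nat (\<lambda>_. 0) (\<lambda>_ g y. max 0 (f y + g (R y)))"
  have X_0: "X 0 y = 0" and X_Suc: "X (Suc n) y = max 0 (f y + X n (R y))" for n y
    by (simp_all add: X_def)
  have X_nonneg: "0 \<le> X n y" for n y by (cases n) (simp_all add: X_0 X_Suc)
  have X_mono: "X n y \<le> X n' y" if "n \<le> n'" for n n' y
  proof (rule lift_Suc_mono_le[OF _ that])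
    show "X n y \<le> X (Suc n) y" for n
    proof (induction n arbitrary: y)
      case (Suc n)
      show ?case using Suc[of "R y"] unfolding X_Suc[of _ y] by simp
    qed (simp add: X_0 X_nonneg)
  qed
  have X_int: "integrable M (X n)" for n
  proof (induction n)
    case (Suc n)
    from integrable_funpow[OF Suc, of 1] have "integrable M (\<lambda>y. X n (R y))" by simp
    with f have "integrable M (\<lambda>y. max 0 (f y + X n (R y)))" by simp
    then show ?case by (simp add: X_Suc[abs_def])
  qed (simp add: X_0[abs_def])
  have [measurable]: "X n \<in> borel_measurable M" for n using X_int by auto
  have sum_Suc: "roof_sum R f (Suc n) y = f y + roof_sum R f n (R y)" for n y
    unfolding roof_sum_def by (subst sum.lessThan_Suc_shift) (simp add: funpow_swap1)
  have sum_le_X: "roof_sum R f n y \<le> X n y" for n y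
  proof (induction n arbitrary: y)
    case 0
    then show ?case by (simp add: roof_sum_def X_0)
  next
    case (Suc n)
    from Suc[of "R y"] show ?case unfolding sum_Suc X_Suc by simp
  qed
  define E where "E = {y \<in> space M. \<forall>i. \<exists>n. real i < X n y}"
  have E_sets [measurable]: "E \<in> sets M" unfolding E_def by measurable
  have E_iff: "(\<forall>i. \<exists>n. real i < X n (R y)) \<longleftrightarrow> (\<forall>i. \<exists>n. real i < X n y)" for y
  proof
    assume l: "\<forall>i. \<exists>n. real i < X n (R y)"
    show "\<forall>i. \<exists>n. real i < X n y"
    proof
      fix i
      obtain j where "real i - f y < real j" using reals_Archimedean2 by blast
      moreover obtain n where "real j < X n (R y)" using l by blast
      ultimately have "real i < X (Suc n) y" unfolding X_Suc by simp
      then show "\<exists>n. real i < X n y" by blast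
    qed
  next
    assume l: "\<forall>i. \<exists>n. real i < X n y"
    show "\<forall>i. \<exists>n. real i < X n (R y)"
    proof
      fix i
      obtain j where "real i + f y < real j" using reals_Archimedean2 by blast
      moreover obtain n where n: "real j < X n y" using l by blast
      moreover have "real j < X (Suc n) y" using n X_mono[of n "Suc n" y] by simp
      ultimately have "real i < X n (R y)" unfolding X_Suc by simp
      then show "\<exists>n. real i < X n (R y)" by blast
    qed
  qed
  have "R -` E \<inter> space M = E"
    using E_iff measurable_space[OF R_measurable] by (auto simp: E_def)
  then consider "measure M E = 0" | "measure M (space M - E) = 0"
    using ergodic E_sets unfolding ergodic_on_def by blast
  then show ?thesis
  proof cases
    case 1
    then have "AE y in M. y \<notin> E"
      using E_sets by (simp add: AE_iff_measurable emeasure_eq_measure AE_not_in null_setsI)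
    then show ?thesis
    proof (rule AE_mp, intro AE_I2 impI)
      fix y assume y: "y \<in> space M" "y \<notin> E"
      then obtain i where "\<And>n. X n y \<le> real i" by (auto simp: E_def not_less)
      then show "\<exists>K. \<forall>n. roof_sum R f n y \<le> K" using sum_le_X order_trans by blast
    qed
  next
    case 2
    define g where "g n y = X (Suc n) y - X n (R y)" for n y
    have g_eq: "g n y = max (- X n (R y)) (f y)" for n y by (auto simp: g_def X_Suc max_def)
    have "(\<lambda>n. \<integral>y. g n y \<partial>M) \<longlonglongrightarrow> (\<integral>y. f y \<partial>M)"
    proof (rule integral_dominated_convergence[where w = "\<lambda>y. \<bar>f y\<bar>"])
      have "AE y in M. y \<notin> space M - E"
        using 2 E_sets by (intro AE_not_in null_setsI) (auto simp: emeasure_eq_measure)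
      then show "AE y in M. (\<lambda>n. g n y) \<longlonglongrightarrow> f y"
      proof (rule AE_mp, intro AE_I2 impI)
        fix y assume y: "y \<in> space M" "y \<notin> space M - E"
        then have "\<forall>i. \<exists>n. real i < X n (R y)" by (simp add: E_def E_iff)
        moreover obtain i where i: "- f y < real i" using reals_Archimedean2 by blast
        ultimately obtain n where n: "real i < X n (R y)" by blast
        have "g n' y = f y" if "n \<le> n'" for n'
          using X_mono[OF that, of "R y"] n i by (simp add: g_eq)
        then show "(\<lambda>n. g n y) \<longlonglongrightarrow> f y"
          by (intro tendsto_eventually) (auto simp: eventually_sequentially)
      qed
      show "AE y in M. norm (g n y) \<le> \<bar>f y\<bar>" for n
      proof (rule AE_I2)
        show "norm (g n y) \<le> \<bar>f y\<bar>" for y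
          using X_nonneg[of n "R y"] by (simp add: g_eq)
      qed
    qed (use f in \<open>auto simp: g_def\<close>)
    moreover have "0 \<le> (\<integral>y. g n y \<partial>M)" for n
    proof -
      have "(\<integral>y. X n (R y) \<partial>M) = (\<integral>y. X n y \<partial>M)" using integral_funpow[of "X n" 1] by simp
      moreover have "integrable M (\<lambda>y. X n (R y))" using integrable_funpow[OF X_int, of n 1] by simp
      ultimately have "(\<integral>y. g n y \<partial>M) = (\<integral>y. X (Suc n) y \<partial>M) - (\<integral>y. X n y \<partial>M)"
        unfolding g_def using X_int[of "Suc n"] by simp
      moreover have "(\<integral>y. X n y \<partial>M) \<le> (\<integral>y. X (Suc n) y \<partial>M)"
        using X_int X_mono by (intro integral_mono) auto
      ultimately show ?thesis by simp
    qed
    ultimately have "0 \<le> (\<integral>y. f y \<partial>M)" by (intro LIMSEQ_le_const) auto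
    with neg show ?thesis by simp
  qed
qed

text \<open>Birkhoff's theorem in additive form: apply the previous bound to \<open>f - (\<integral>f + e)\<close> and to
\<open>(\<integral>f - e) - f\<close>, both of mean \<open>- e\<close>.\<close>

lemma AE_roof_sum_near_mean:
  fixes f :: "'a \<Rightarrow> real"
  assumes f: "integrable M f" and "0 < e"
  shows "AE y in M. \<exists>K. \<forall>n. \<bar>roof_sum R f n y - real n * (\<integral>y. f y \<partial>M)\<bar> \<le> e * real n + K"
proof -
  let ?I = "\<integral>y. f y \<partial>M"
  have "AE y in M. \<exists>K. \<forall>n. roof_sum R (\<lambda>y. f y - (?I + e)) n y \<le> K"
    using assms by (intro roof_sum_bdd_above) (simp_all add: prob_space)
  moreover have "AE y in M. \<exists>K. \<forall>n. roof_sum R (\<lambda>y. (?I - e) - f y) n y \<le> K"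
    using assms by (intro roof_sum_bdd_above) (simp_all add: prob_space)
  ultimately show ?thesis
  proof eventually_elim
    case (elim y)
    then obtain K K' where "\<And>n. roof_sum R (\<lambda>y. f y - (?I + e)) n y \<le> K"
      "\<And>n. roof_sum R (\<lambda>y. (?I - e) - f y) n y \<le> K'" by blast
    then have "roof_sum R f n y - real n * ?I \<le> e * real n + K \<and>
      real n * ?I - roof_sum R f n y \<le> e * real n + K'" for n
      unfolding roof_sum_def sum_subtractf by (simp add: algebra_simps)
    then show ?case by (intro exI[of _ "max K K'"]) (smt (verit))
  qed
qed

text \<open>Points at which the error in Birkhoff's theorem is controlled at all times at once.  This uniformity
makes it harmless that the time at which the roof sum is evaluated depends on the point.\<close>

definition regular_set :: "('a \<Rightarrow> real) \<Rightarrow> real \<Rightarrow> nat \<Rightarrow> 'a set" where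
  "regular_set f e K = {y \<in> space M.
     \<forall>n. \<bar>roof_sum R f n y - real n * (\<integral>y. f y \<partial>M)\<bar> \<le> e * real n + real K}"

lemma regular_set_sets [measurable]:
  assumes [measurable]: "f \<in> borel_measurable M"
  shows "regular_set f e K \<in> sets M"
  unfolding regular_set_def by measurable

lemma AE_regular_set:
  assumes "integrable M f" "0 < e"
  shows "AE y in M. \<exists>K. y \<in> regular_set f e K"
  using AE_roof_sum_near_mean[OF assms] AE_space
proof eventually_elim
  case (elim y)
  then obtain K where K: "\<And>n. \<bar>roof_sum R f n y - real n * (\<integral>y. f y \<partial>M)\<bar> \<le> e * real n + K" by blast
  obtain i where "K \<le> real i" using real_arch_simple by blast
  then have "\<bar>roof_sum R f n y - real n * (\<integral>y. f y \<partial>M)\<bar> \<le> e * real n + real i" for n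
    using K[of n] by linarith
  then have "y \<in> regular_set f e i"
    using elim(2) by (simp add: regular_set_def)
  then show ?case by blast
qed

lemma measure_roof_sum_small_tendsto_0:
  assumes f: "integrable M f" and "0 < e"
  shows "(\<lambda>n. measure M {y \<in> space M. roof_sum R f n y < real n * ((\<integral>y. f y \<partial>M) - e)}) \<longlonglongrightarrow> 0"
proof -
  have [measurable]: "f \<in> borel_measurable M" using f by auto
  let ?E = "\<lambda>n. {y \<in> space M. roof_sum R f n y < real n * ((\<integral>y. f y \<partial>M) - e)}"
  have "(\<lambda>n. \<integral>y. indicator (?E n) y \<partial>M) \<longlonglongrightarrow> (\<integral>y. 0 \<partial>M :: real)"
  proof (rule integral_dominated_convergence[where w = "\<lambda>y. 1"])
    show "AE y in M. (\<lambda>n. indicator (?E n) y :: real) \<longlonglongrightarrow> 0"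
      using AE_roof_sum_near_mean[OF f half_gt_zero[OF \<open>0 < e\<close>]]
    proof eventually_elim
      case (elim y)
      then obtain K where
        K: "\<And>n. \<bar>roof_sum R f n y - real n * (\<integral>y. f y \<partial>M)\<bar> \<le> e * real n / 2 + K" by auto
      obtain n0 where n0: "2 * K / e \<le> real n0" using real_arch_simple by blast
      have "indicator (?E n) y = (0::real)" if "n0 \<le> n" for n
      proof -
        have "2 * K / e \<le> real n" using n0 that by simp
        then have "K \<le> e * real n / 2" using \<open>0 < e\<close> by (simp add: field_simps)
        moreover have "real n * (\<integral>y. f y \<partial>M) - roof_sum R f n y \<le> e * real n / 2 + K"
          using K[of n] by simp
        ultimately have "real n * (\<integral>y. f y \<partial>M) - roof_sum R f n y \<le> e * real n" by simp
        then show ?thesis by (simp add: right_diff_distrib mult.commute)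
      qed
      then show ?case by (intro tendsto_eventually eventually_sequentiallyI)
    qed
  qed auto
  then show ?thesis by (simp add: measure_def[symmetric])
qed

section \<open>Asymptotically invariant events\<close>

text \<open>By invariance of the measure, \<open>\<integral>\<^sub>E f\<close> is the average over \<open>j < J\<close> of the integrals of
\<open>f \<circ> R\<^sup>j\<close> over the preimages of \<open>E\<close>.  All these preimages contain \<open>E - D\<close>, and
there the averages of \<open>f\<close> are at least \<open>c\<close> except on the set subtracted last.\<close>

lemma integral_lower_bound:
  fixes f :: "'a \<Rightarrow> real"
  assumes f: "integrable M f" "\<And>y. 0 \<le> f y" and c: "0 \<le> c" and J: "0 < J"
    and [measurable]: "E \<in> sets M" "D \<in> sets M"
    and inv: "\<And>y j. y \<in> E \<Longrightarrow> y \<notin> D \<Longrightarrow> j < J \<Longrightarrow> (R ^^ j) y \<in> E"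
  shows "c * (measure M E - measure M D - measure M {y \<in> space M. roof_sum R f J y < real J * c})
    \<le> (\<integral>y. indicator E y * f y \<partial>M)"
proof -
  have [measurable]: "f \<in> borel_measurable M" using f by auto
  let ?N = "{y \<in> space M. roof_sum R f J y < real J * c}"
  define G where "G = E - D - ?N"
  have [measurable]: "G \<in> sets M" unfolding G_def by measurable
  have int: "integrable M (\<lambda>y. indicator E y * f y)"
    using integrable_real_mult_indicator[OF assms(5) f(1)] by (simp add: mult.commute)
  have int': "integrable M (\<lambda>y. indicator E ((R ^^ j) y) * f ((R ^^ j) y))" for j
    using integrable_funpow[OF int] .
  have "measure M E \<le> measure M (G \<union> D \<union> ?N)" by (rule finite_measure_mono) (auto simp: G_def)
  also have "\<dots> \<le> measure M G + measure M D + measure M ?N"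
    using measure_Un_le[of "G \<union> D" M ?N] measure_Un_le[of G M D] by simp
  finally have G: "measure M E - measure M D - measure M ?N \<le> measure M G" by simp
  have "real J * (c * measure M G) = (\<integral>y. indicator G y * (real J * c) \<partial>M)"
    by simp
  also have "\<dots> \<le> (\<integral>y. (\<Sum>j<J. indicator E ((R ^^ j) y) * f ((R ^^ j) y)) \<partial>M)"
  proof (rule integral_mono)
    fix y assume "y \<in> space M"
    show "indicator G y * (real J * c) \<le> (\<Sum>j<J. indicator E ((R ^^ j) y) * f ((R ^^ j) y))"
    proof (cases "y \<in> G")
      case True
      then have "(\<Sum>j<J. indicator E ((R ^^ j) y) * f ((R ^^ j) y)) = roof_sum R f J y"
        unfolding roof_sum_def using inv by (intro sum.cong) (auto simp: G_def)
      with True \<open>y \<in> space M\<close> show ?thesis by (auto simp: G_def)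
    next
      case False
      then show ?thesis using f(2) by (auto intro!: sum_nonneg)
    qed
  next
    have "integrable M (\<lambda>y. indicator G y :: real)"
      by (intro integrable_real_indicator) (auto simp: emeasure_eq_measure)
    then show "integrable M (\<lambda>y. indicator G y * (real J * c))" by (rule integrable_mult_left)
    show "integrable M (\<lambda>y. \<Sum>j<J. indicator E ((R ^^ j) y) * f ((R ^^ j) y))"
      by (intro Bochner_Integration.integrable_sum int')
  qed
  also have "\<dots> = (\<Sum>j<J. \<integral>y. indicator E ((R ^^ j) y) * f ((R ^^ j) y) \<partial>M)"
    by (intro Bochner_Integration.integral_sum int')
  also have "\<dots> = real J * (\<integral>y. indicator E y * f y \<partial>M)"
    using integral_funpow[of "\<lambda>y. indicator E y * f y"] by simp
  finally have "c * measure M G \<le> (\<integral>y. indicator E y * f y \<partial>M)" using J by simp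
  then show ?thesis using mult_left_mono[OF G c] by linarith
qed

text \<open>Events that the map changes only on small sets have asymptotically the same probability under all
absolutely continuous probabilities.  The lower bound above, applied to the events and to their
complements, gives both inequalities.\<close>

lemma density_asymptotically_invariant:
  fixes f :: "'a \<Rightarrow> real" and E :: "'i \<Rightarrow> 'a set"
  assumes f: "integrable M f" "\<And>y. 0 \<le> f y" "(\<integral>y. f y \<partial>M) = 1"
    and E: "\<And>i. E i \<in> sets M" and D: "\<And>J i. D J i \<in> sets M"
    and D_small: "\<And>J. ((\<lambda>i. measure M (D J i)) \<longlongrightarrow> 0) F"
    and inv: "\<And>J i j y. y \<in> space M \<Longrightarrow> y \<notin> D J i \<Longrightarrow> j < J \<Longrightarrow> (R ^^ j) y \<in> E i \<longleftrightarrow> y \<in> E i"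
  shows "((\<lambda>i. (\<integral>y. indicator (E i) y * f y \<partial>M) - measure M (E i)) \<longlongrightarrow> 0) F"
proof (rule tendstoI)
  fix \<eta> :: real assume "0 < \<eta>"
  define e where "e = min 1 (\<eta> / 4)"
  have e: "0 < e" "e \<le> 1" "e \<le> \<eta> / 4" using \<open>0 < \<eta>\<close> by (auto simp: e_def)
  let ?N = "\<lambda>J. {y \<in> space M. roof_sum R f J y < real J * (1 - e)}"
  have "\<forall>\<^sub>F J in sequentially. measure M (?N J) < e"
    using measure_roof_sum_small_tendsto_0[OF f(1) e(1)] e(1) unfolding f(3) by (rule order_tendstoD(2))
  then obtain J where J: "0 < J" "measure M (?N J) < e"
    using eventually_gt_at_top[of "0::nat"] by (metis (mono_tags, lifting) eventually_happens' eventually_conj sequentially_bot)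
  have lower: "measure M X - 3 * e < (\<integral>y. indicator X y * f y \<partial>M)"
    if X: "X \<in> sets M" and small: "measure M (D J i) < e"
      and inv_X: "\<And>y j. y \<in> X \<Longrightarrow> y \<notin> D J i \<Longrightarrow> j < J \<Longrightarrow> (R ^^ j) y \<in> X" for X i
  proof -
    have "(1 - e) * (measure M X - measure M (D J i) - measure M (?N J)) \<le> (\<integral>y. indicator X y * f y \<partial>M)"
      using integral_lower_bound[OF f(1,2) _ J(1) X D inv_X, of "1 - e"] e by simp
    moreover have "(1 - e) * (measure M X - 2 * e) \<le>
        (1 - e) * (measure M X - measure M (D J i) - measure M (?N J))"
      using e small J(2) by (intro mult_left_mono) auto
    moreover have "e * measure M X \<le> e * 1" "0 < e * e" using e by (auto intro!: mult_left_mono)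
    then have "measure M X - 3 * e < (1 - e) * (measure M X - 2 * e)"
      by (simp add: algebra_simps)
    ultimately show ?thesis by linarith
  qed
  have "\<forall>\<^sub>F i in F. measure M (D J i) < e" using D_small e(1) by (rule order_tendstoD(2))
  then show "\<forall>\<^sub>F i in F. dist ((\<integral>y. indicator (E i) y * f y \<partial>M) - measure M (E i)) 0 < \<eta>"
  proof eventually_elim
    case (elim i)
    have space: "y \<in> X \<Longrightarrow> y \<in> space M" if "X \<in> sets M" for X y
      using sets.sets_into_space[OF that] by blast
    have "measure M (E i) - 3 * e < (\<integral>y. indicator (E i) y * f y \<partial>M)"
      using inv space[OF E] by (intro lower[OF E elim]) blast
    moreover have "measure M (space M - E i) - 3 * e < (\<integral>y. indicator (space M - E i) y * f y \<partial>M)"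
      using inv measurable_space[OF funpow_measurable] by (intro lower[OF _ elim]) (use E in auto)
    moreover have "(\<integral>y. indicator (space M - E i) y * f y \<partial>M) = 1 - (\<integral>y. indicator (E i) y * f y \<partial>M)"
    proof -
      have "integrable M (\<lambda>y. indicator (E i) y * f y)"
        using integrable_real_mult_indicator[OF E f(1)] by (simp add: mult.commute)
      then have "(\<integral>y. f y - indicator (E i) y * f y \<partial>M) = 1 - (\<integral>y. indicator (E i) y * f y \<partial>M)"
        using f by simp
      moreover have "(\<integral>y. indicator (space M - E i) y * f y \<partial>M) = (\<integral>y. f y - indicator (E i) y * f y \<partial>M)"
        by (rule Bochner_Integration.integral_cong) (auto simp: indicator_def)
      ultimately show ?thesis by simp
    qed
    ultimately show ?case using e E[of i] by (simp add: prob_compl dist_real_def)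
  qed
qed

end

section \<open>Probabilities of visits\<close>

context measure_preserving_map begin

lemma visits_measurable [measurable]:
  assumes [measurable]: "A \<in> sets M"
  shows "visits R A n \<in> measurable M (count_space UNIV)"
proof (induction n)
  case 0
  then show ?case by (simp add: visits_def[abs_def])
next
  case (Suc n)
  have [measurable]: "(\<lambda>y. Suc (visits R A n y)) \<in> measurable M (count_space UNIV)"
    by (rule measurable_compose[OF Suc]) simp
  note Suc [measurable]
  have "visits R A (Suc n) =
      (\<lambda>y. if (R ^^ Suc n) y \<in> A then Suc (visits R A n y) else visits R A n y)"
    by (auto simp: visits_Suc)
  also have "\<dots> \<in> measurable M (count_space UNIV)" by measurable
  finally show ?case .
qed

lemma visits_ge_measurable [measurable]:
  assumes [measurable]: "A \<in> sets M"
  shows "Measurable.pred M (\<lambda>y. m \<le> visits R A n y)"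
  by (rule measurable_compose[OF visits_measurable[OF assms]]) simp

lemma visits_neq_sets [measurable]:
  assumes A [measurable]: "A \<in> sets M"
  shows "{y \<in> space M. visits R A n y \<noteq> visits R A n' y} \<in> sets M"
proof -
  have "{y \<in> space M. visits R A n y \<noteq> visits R A n' y} =
      {y \<in> space M. \<exists>k. visits R A n y = k \<and> visits R A n' y \<noteq> k}" by auto
  moreover have "{y \<in> space M. \<exists>k. visits R A n y = k \<and> visits R A n' y \<noteq> k} \<in> sets M" by measurable
  ultimately show ?thesis by (simp only:)
qed

lemma measure_visits_window:
  assumes A: "A \<in> sets M"
  shows "measure M {y \<in> space M. visits R A (n + j) y \<noteq> visits R A n y} \<le> real j * measure M A"
proof -
  let ?V = "\<lambda>k. (R ^^ k) -` A \<inter> space M"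
  have V: "?V k \<in> sets M" for k using A by (rule measurable_sets[OF funpow_measurable])
  have "visits R A (n + j) y = visits R A n y" if "\<forall>k\<in>{n<..n+j}. (R ^^ k) y \<notin> A" for y
    using that by (induction j) (simp_all add: visits_Suc del: funpow.simps)
  then have "{y \<in> space M. visits R A (n + j) y \<noteq> visits R A n y} \<subseteq> (\<Union>k\<in>{n<..n+j}. ?V k)"
    by blast
  then have "measure M {y \<in> space M. visits R A (n + j) y \<noteq> visits R A n y} \<le> measure M (\<Union>k\<in>{n<..n+j}. ?V k)"
    using V by (intro finite_measure_mono sets.finite_UN) auto
  also have "\<dots> \<le> (\<Sum>k\<in>{n<..n+j}. measure M (?V k))"
    using V by (intro finite_measure_subadditive_finite) auto
  also have "\<dots> = real j * measure M A" using A by (simp add: measure_funpow)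
  finally show ?thesis .
qed

end

section \<open>The suspension measure\<close>

text \<open>Continuity of the measure from below, in the form in which the constants in the bounds on unbounded
quantities are chosen.\<close>

lemma (in prob_space) exhausting_events:
  assumes "\<And>K::nat. G K \<in> events" "incseq G" "AE z in M. \<exists>K. z \<in> G K" "0 < \<eta>"
  shows "\<exists>K. prob (space M - G K) < \<eta>"
proof -
  have "(\<lambda>K. prob (G K)) \<longlonglongrightarrow> prob (\<Union>K. G K)"
    using assms by (intro finite_Lim_measure_incseq) auto
  moreover have "prob (\<Union>K. G K) = 1"
    using assms by (subst prob_eq_1) auto
  ultimately have "\<forall>\<^sub>F K in sequentially. 1 - \<eta> < prob (G K)"
    using assms(4) by (intro order_tendstoD(1)) auto
  then obtain K where "1 - \<eta> < prob (G K)" by (auto simp: eventually_sequentially)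
  then show ?thesis using assms(1) by (intro exI[of _ K]) (simp add: prob_compl)
qed

locale suspension = ergodic_map M R for M :: "'a measure" and R +
  fixes r :: "'a \<Rightarrow> real"
  assumes space_M: "space M = UNIV"
    and r_pos: "\<And>y. 0 < r y"
    and r_integrable: "integrable M r"
begin

definition "rbar = (\<integral>y. r y \<partial>M)"
abbreviation "P \<equiv> susp_measure M r"
abbreviation "X \<equiv> susp_space r"

lemma r_measurable [measurable]: "r \<in> borel_measurable M"
  using r_integrable by auto

lemma rbar_pos: "0 < rbar"
proof -
  have "0 \<le> rbar" unfolding rbar_def using r_pos by (intro Bochner_Integration.integral_nonneg) (auto intro: less_imp_le)
  moreover have "rbar \<noteq> 0"
  proof
    assume "rbar = 0"
    then have "AE y in M. r y = 0"
      using r_integrable r_pos unfolding rbar_def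
      by (subst (asm) integral_nonneg_eq_0_iff_AE) (auto intro: less_imp_le)
    then have "AE y in M. False" by eventually_elim (use r_pos less_irrefl in metis)
    then show False by simp
  qed
  ultimately show ?thesis by simp
qed

lemma space_P: "space P = X"
  by (simp add: susp_measure_def space_scale_measure space_restrict_space space_pair_measure space_M)

lemma X_sets [measurable]: "X \<in> sets (M \<Otimes>\<^sub>M lborel)"
proof -
  have "X = {z \<in> space (M \<Otimes>\<^sub>M lborel). 0 \<le> snd z \<and> snd z < r (fst z)}"
    by (auto simp: susp_space_def space_pair_measure space_M)
  also have "\<dots> \<in> sets (M \<Otimes>\<^sub>M lborel)" by measurable
  finally show ?thesis .
qed

lemma sets_P_iff: "Y \<in> sets P \<longleftrightarrow> Y \<subseteq> X \<and> Y \<in> sets (M \<Otimes>\<^sub>M lborel)"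
proof -
  have "X \<inter> space (M \<Otimes>\<^sub>M lborel) \<in> sets (M \<Otimes>\<^sub>M lborel)" by measurable
  then show ?thesis
    unfolding susp_measure_def sets_scale_measure by (rule sets_restrict_space_iff)
qed

lemma Collect_sets_P:
  assumes "Measurable.pred (M \<Otimes>\<^sub>M lborel) Q"
  shows "{z \<in> X. Q z} \<in> sets P"
proof -
  have "{z \<in> X. Q z} = X \<inter> {z \<in> space (M \<Otimes>\<^sub>M lborel). Q z}"
    by (auto simp: space_pair_measure space_M)
  moreover have "\<dots> \<in> sets (M \<Otimes>\<^sub>M lborel)" using X_sets assms by (intro sets.Int) (auto simp: pred_def)
  ultimately show ?thesis unfolding sets_P_iff by auto
qed

lemma emeasure_P:
  assumes "Y \<in> sets P"
    and fibre: "\<And>y. emeasure lborel (Pair y -` Y) = ennreal (g y)"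
    and g: "integrable M g" "\<And>y. 0 \<le> g y"
  shows "emeasure P Y = ennreal ((\<integral>y. g y \<partial>M) / rbar)"
proof -
  have Y: "Y \<subseteq> X" "Y \<in> sets (M \<Otimes>\<^sub>M lborel)" using assms(1) by (auto simp: sets_P_iff)
  have "emeasure P Y = ennreal (1 / rbar) * emeasure (M \<Otimes>\<^sub>M lborel) Y"
  proof -
    have "X \<inter> space (M \<Otimes>\<^sub>M lborel) \<in> sets (M \<Otimes>\<^sub>M lborel)" by measurable
    then show ?thesis
      unfolding susp_measure_def rbar_def using Y(1)
      by (simp add: emeasure_scale_measure emeasure_restrict_space)
  qed
  also have "emeasure (M \<Otimes>\<^sub>M lborel) Y = (\<integral>\<^sup>+y. ennreal (g y) \<partial>M)"
    using Y by (simp add: lborel.emeasure_pair_measure_alt fibre)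
  also have "\<dots> = ennreal (\<integral>y. g y \<partial>M)" using g by (intro nn_integral_eq_integral) auto
  also have "ennreal (1 / rbar) * \<dots> = ennreal ((\<integral>y. g y \<partial>M) / rbar)"
    using rbar_pos g by (simp add: ennreal_mult' [symmetric])
  finally show ?thesis .
qed

lemma measure_P:
  assumes "Y \<in> sets P" "\<And>y. emeasure lborel (Pair y -` Y) = ennreal (g y)"
    and "integrable M g" "\<And>y. 0 \<le> g y"
  shows "measure P Y = (\<integral>y. g y \<partial>M) / rbar"
  using emeasure_P[OF assms] assms(3,4) rbar_pos by (simp add: measure_def integral_nonneg)

lemma Pair_vimage_base: "Pair y -` {z \<in> X. fst z \<in> E} = (if y \<in> E then {0..<r y} else {})"
  by (auto simp: susp_space_def)

text \<open>The projection of the suspension measure to the base has density \<open>r / rbar\<close>.\<close>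

lemma measure_P_base:
  assumes [measurable]: "E \<in> sets M"
  shows "measure P {z \<in> X. fst z \<in> E} = (\<integral>y. indicator E y * (r y / rbar) \<partial>M)"
proof -
  have "measure P {z \<in> X. fst z \<in> E} = (\<integral>y. indicator E y * r y \<partial>M) / rbar"
  proof (rule measure_P)
    show "{z \<in> X. fst z \<in> E} \<in> sets P" by (rule Collect_sets_P) measurable
    show "integrable M (\<lambda>y. indicator E y * r y)"
      using integrable_real_mult_indicator[OF assms r_integrable] by (simp add: mult.commute)
    show "emeasure lborel (Pair y -` {z \<in> X. fst z \<in> E}) = ennreal (indicator E y * r y)" for y
      unfolding Pair_vimage_base using r_pos[of y] by simp
  qed (use r_pos in \<open>auto simp: less_imp_le\<close>)
  then show ?thesis by simp
qed

text \<open>Below a fixed height the suspension measure is bounded by a multiple of the base measure.  As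
high points are rare, this makes the set of points over a small base set small, although the roof may
be unbounded.\<close>

lemma measure_P_low:
  assumes [measurable]: "E \<in> sets M" and "0 \<le> K"
  shows "measure P {z \<in> X. fst z \<in> E \<and> snd z \<le> K} \<le> K * measure M E / rbar"
proof -
  have int: "integrable M (\<lambda>y. indicator E y * K)"
    by (intro integrable_mult_left integrable_real_indicator) (auto simp: emeasure_eq_measure)
  have int': "integrable M (\<lambda>y. indicator E y * min (r y) K)"
    using int by (rule Bochner_Integration.integrable_bound)
      (use assms r_pos in \<open>auto simp: indicator_def less_imp_le\<close>)
  have "measure P {z \<in> X. fst z \<in> E \<and> snd z \<le> K} = (\<integral>y. indicator E y * min (r y) K \<partial>M) / rbar"
  proof (rule measure_P)
    show "{z \<in> X. fst z \<in> E \<and> snd z \<le> K} \<in> sets P" by (rule Collect_sets_P) measurable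
    show "emeasure lborel (Pair y -` {z \<in> X. fst z \<in> E \<and> snd z \<le> K}) = ennreal (indicator E y * min (r y) K)" for y
    proof -
      have "Pair y -` {z \<in> X. fst z \<in> E \<and> snd z \<le> K} =
        (if y \<in> E then if r y \<le> K then {0..<r y} else {0..K} else {})"
        by (auto simp: susp_space_def)
      then show ?thesis using r_pos[of y] assms by simp
    qed
  qed (use int' assms r_pos in \<open>auto simp: less_imp_le\<close>)
  also have "\<dots> \<le> (\<integral>y. indicator E y * K \<partial>M) / rbar"
    using rbar_pos int int'
    by (intro divide_right_mono integral_mono) (auto simp: indicator_def)
  finally show ?thesis by (simp add: mult.commute)
qed

lemma measure_P_box:
  assumes [measurable]: "A \<in> sets M" and "A \<times> {a..b} \<subseteq> X" "a \<le> b"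
  shows "measure P (A \<times> {a..b}) = (b - a) * measure M A / rbar"
proof -
  have "measure P (A \<times> {a..b}) = (\<integral>y. indicator A y * (b - a) \<partial>M) / rbar"
  proof (rule measure_P)
    show "A \<times> {a..b} \<in> sets P" unfolding sets_P_iff using assms(2) by simp
    show "emeasure lborel (Pair y -` (A \<times> {a..b})) = ennreal (indicator A y * (b - a))" for y
    proof -
      have "Pair y -` (A \<times> {a..b}) = (if y \<in> A then {a..b} else {})" by auto
      then show ?thesis using assms(3) by simp
    qed
    show "integrable M (\<lambda>y. indicator A y * (b - a))"
      by (intro integrable_mult_left integrable_real_indicator) (auto simp: emeasure_eq_measure)
  qed (use assms in auto)
  then show ?thesis by (simp add: mult.commute)
qed

sublocale P: prob_space P
proof
  have "emeasure P X = ennreal ((\<integral>y. r y \<partial>M) / rbar)"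
  proof (rule emeasure_P)
    show "X \<in> sets P" unfolding sets_P_iff using X_sets by blast
    show "emeasure lborel (Pair y -` X) = ennreal (r y)" for y
      using Pair_vimage_base[of y UNIV] r_pos[of y] by simp
  qed (use r_integrable r_pos in \<open>auto simp: less_imp_le\<close>)
  then show "emeasure P (space P) = 1" using rbar_pos by (simp add: space_P rbar_def)
qed

lemma AE_P_fst:
  assumes "AE y in M. Q y"
  shows "AE z in P. Q (fst z)"
proof -
  obtain N where N: "{y \<in> space M. \<not> Q y} \<subseteq> N" "N \<in> null_sets M"
    using assms by (auto simp: eventually_ae_filter)
  have N_sets [measurable]: "N \<in> sets M" using N by auto
  have "AE y in M. indicator N y * (r y / rbar) = 0"
    using AE_not_in[OF N(2)] by eventually_elim simp
  then have "(\<integral>y. indicator N y * (r y / rbar) \<partial>M) = 0" by (rule integral_eq_zero_AE)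
  then have "measure P {z \<in> X. fst z \<in> N} = 0" using measure_P_base N_sets by simp
  moreover have "{z \<in> X. fst z \<in> N} \<in> sets P" by (rule Collect_sets_P) measurable
  ultimately have "{z \<in> X. fst z \<in> N} \<in> null_sets P"
    by (auto simp: P.emeasure_eq_measure)
  then show ?thesis
    by (rule AE_I') (use N(1) in \<open>auto simp: space_P space_M\<close>)
qed

lemma flow_hit_le_sets:
  assumes box: "roof_box r A a b" and A [measurable]: "A \<in> sets M"
  shows "{z \<in> X. flow_hit (susp_flow R r) (A \<times> {a..b}) m z \<le> ereal c} \<in> sets P"
proof (cases m)
  case 0
  show ?thesis unfolding 0 flow_hit.simps(1) by (rule Collect_sets_P) simp
next
  case (Suc m')
  note [measurable] = measurable_compose[OF measurable_fst visits_ge_measurable[OF A]]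
  have "{z \<in> X. \<exists>k. (if fst z \<in> A \<and> snd z < a then m' \<le> visits R A k (fst z) else Suc m' \<le> visits R A k (fst z))
       \<and> roof_sum R r k (fst z) + a - snd z \<le> c} \<in> sets P"
    by (rule Collect_sets_P) measurable
  moreover have "{z \<in> X. flow_hit (susp_flow R r) (A \<times> {a..b}) (Suc m') z \<le> ereal c} =
    {z \<in> X. \<exists>k. (if fst z \<in> A \<and> snd z < a then m' \<le> visits R A k (fst z) else Suc m' \<le> visits R A k (fst z))
       \<and> roof_sum R r k (fst z) + a - snd z \<le> c}"
    by (rule Collect_cong, rule conj_cong[OF refl], rule roof_box.flow_hit_Suc_le_iff[OF box])
  ultimately show ?thesis unfolding Suc by (simp only:)
qed

end

section \<open>From the law of the map to the law of the flow\<close>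

context suspension begin

text \<open>The visit counts up to time \<open>N i\<close> have asymptotically the same law under the measure of the
base and under the projection of the suspension measure, which has density \<open>r / rbar\<close>.  A shift
by fewer than \<open>J\<close> steps changes a count only if there is a visit in one of two windows of length
\<open>J\<close>, which has probability at most \<open>2 J\<close> times the measure of the target.\<close>

lemma visits_law_transfer:
  fixes A :: "'i \<Rightarrow> 'a set" and N :: "'i \<Rightarrow> nat"
  assumes A [measurable]: "\<And>i. A i \<in> sets M"
    and small: "((\<lambda>i. measure M (A i)) \<longlongrightarrow> 0) F"
  shows "((\<lambda>i. measure P {z \<in> X. visits R (A i) (N i) (fst z) = m}
      - measure M {y \<in> space M. visits R (A i) (N i) y = m}) \<longlongrightarrow> 0) F"
proof -
  define E where "E i = {y \<in> space M. visits R (A i) (N i) y = m}" for i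
  define D where "D J i = {y \<in> space M. visits R (A i) (0 + J) y \<noteq> visits R (A i) 0 y} \<union>
     {y \<in> space M. visits R (A i) (N i + J) y \<noteq> visits R (A i) (N i) y}" for J i
  have E_sets [measurable]: "E i \<in> sets M" for i unfolding E_def by measurable
  have D_sets: "D J i \<in> sets M" for J i unfolding D_def by (intro sets.Un visits_neq_sets A)
  have "((\<lambda>i. (\<integral>y. indicator (E i) y * (r y / rbar) \<partial>M) - measure M (E i)) \<longlongrightarrow> 0) F"
  proof (rule density_asymptotically_invariant[where D = D])
    show "(\<integral>y. r y / rbar \<partial>M) = 1" using rbar_pos by (simp flip: rbar_def)
    show "((\<lambda>i. measure M (D J i)) \<longlongrightarrow> 0) F" for J
    proof (rule tendsto_sandwich[OF _ _ tendsto_const])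
      have "measure M (D J i) \<le> 2 * real J * measure M (A i)" for i
      proof -
        have "measure M (D J i) \<le> measure M {y \<in> space M. visits R (A i) (0 + J) y \<noteq> visits R (A i) 0 y} +
          measure M {y \<in> space M. visits R (A i) (N i + J) y \<noteq> visits R (A i) (N i) y}"
          unfolding D_def by (intro measure_Un_le visits_neq_sets A)
        then show ?thesis
          using measure_visits_window[OF A, of i 0 J] measure_visits_window[OF A, of i "N i" J] by linarith
      qed
      then show "\<forall>\<^sub>F i in F. measure M (D J i) \<le> 2 * real J * measure M (A i)" by simp
      show "((\<lambda>i. 2 * real J * measure M (A i)) \<longlongrightarrow> 0) F"
        using tendsto_mult_right_zero[OF small] .
    qed simp
    show "(R ^^ j) y \<in> E i \<longleftrightarrow> y \<in> E i" if y: "y \<in> space M" "y \<notin> D J i" "j < J" for J i j y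
    proof -
      have "visits R (A i) j y = 0"
        using y visits_mono[of j J R "A i" y] by (simp add: D_def)
      moreover have "visits R (A i) (N i + j) y = visits R (A i) (N i) y"
        using y visits_mono[of "N i + j" "N i + J" R "A i" y] visits_mono[of "N i" "N i + j" R "A i" y]
        by (simp add: D_def)
      ultimately show ?thesis by (simp add: E_def visits_shift space_M)
    qed
  qed (use r_integrable r_pos rbar_pos E_sets D_sets in \<open>auto simp: less_imp_le\<close>)
  moreover have "(\<integral>y. indicator (E i) y * (r y / rbar) \<partial>M) =
      measure P {z \<in> X. visits R (A i) (N i) (fst z) = m}" for i
    using measure_P_base[OF E_sets[of i]] by (simp add: E_def space_M)
  ultimately show ?thesis by (simp add: E_def)
qed

text \<open>At a point where Birkhoff sums are controlled, the roof sum passes \<open>rbar * c\<close> between the indices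
\<open>(1 - e) c\<close> and \<open>(1 + e) c\<close>.  If there is no visit in between, then the flow has as many
hits before time \<open>rbar * c\<close> as the map has up to index \<open>c\<close>.\<close>

lemma flow_event_iff:
  assumes box: "roof_box r A a b" and c: "0 < c" and e: "0 < e" "e \<le> 1"
    and z: "(y, u) \<in> X" "y \<notin> A" "u \<le> K'" and y: "y \<in> regular_set r (e * rbar / 4) K"
    and late: "2 * (real K + K' + b) < e * rbar * c"
    and no_visit: "visits R A (nat \<lceil>(1 + e) * c\<rceil>) y = visits R A (nat \<lfloor>(1 - e) * c\<rfloor>) y"
  shows "flow_hit (susp_flow R r) (A \<times> {a..b}) m (y, u) \<le> ereal (rbar * c) \<and>
      ereal (rbar * c) < flow_hit (susp_flow R r) (A \<times> {a..b}) (m + 1) (y, u)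
    \<longleftrightarrow> visits R A (nat \<lfloor>c\<rfloor>) y = m"
proof -
  interpret roof_box R r A a b using box .
  define L H where "L = nat \<lfloor>(1 - e) * c\<rfloor>" and "H = nat \<lceil>(1 + e) * c\<rceil>"
  have u: "0 \<le> u" using z by (auto simp: susp_space_def)
  have L: "real L \<le> (1 - e) * c" unfolding L_def using c e by simp
  have H: "(1 + e) * c \<le> real H" unfolding H_def by (rule real_nat_ceiling_ge)
  have "(1 - e) * c \<le> c" "c \<le> (1 + e) * c" using c e by (auto simp: algebra_simps)
  then have LN: "L \<le> nat \<lfloor>c\<rfloor>" "nat \<lfloor>c\<rfloor> \<le> H"
    unfolding L_def H_def by (auto intro!: nat_mono floor_mono simp: nat_le_iff) linarith
  \<comment> \<open>an error of \<open>d\<close> per step in the roof sum consumes at most half of the margin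
\<open>e * rbar * c\<close>, and the other half covers the bounded terms\<close>
  define d where "d = e * rbar / 4"
  have d: "e * rbar = 4 * d" "0 < d" "d \<le> rbar" "0 < c * d" "0 \<le> e * (c * d)" "e * (c * d) \<le> 1 * (c * d)"
  proof -
    show "0 < d" using e rbar_pos by (simp add: d_def)
    show "d \<le> rbar" using mult_right_mono[OF e(2), of rbar] rbar_pos by (simp add: d_def)
    show "0 < c * d" using c \<open>0 < d\<close> by simp
    then show "0 \<le> e * (c * d)" "e * (c * d) \<le> 1 * (c * d)"
      using e by (simp_all only: mult_nonneg_nonneg less_imp_le mult_right_mono)
  qed (simp add: d_def)
  have late': "2 * (real K + K' + b) < 4 * (c * d)"
    using late unfolding d(1) by (simp only: mult_ac)
  have reg: "\<bar>S n y - real n * rbar\<bar> \<le> d * real n + real K" for n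
    using y by (simp add: regular_set_def rbar_def d_def)
  have "S L y \<le> real L * (rbar + d) + real K"
    using reg[of L] by (simp add: algebra_simps)
  also have "\<dots> \<le> (1 - e) * c * (rbar + d) + real K"
    using L d rbar_pos by (intro add_right_mono mult_right_mono) auto
  also have "(1 - e) * c * (rbar + d) = rbar * c + c * d - c * (e * rbar) - e * (c * d)"
    by (simp add: algebra_simps)
  finally have "S L y + a - u \<le> rbar * c"
    using late' u z(3) a_less_b d(4,5) unfolding d(1) by simp
  moreover have "rbar * c < S H y + a - u"
  proof -
    have "(1 + e) * c * (rbar - d) - real K \<le> real H * (rbar - d) - real K"
      using H d by (intro diff_right_mono mult_right_mono) auto
    also have "\<dots> \<le> S H y" using reg[of H] by (simp add: algebra_simps)
    also have "(1 + e) * c * (rbar - d) = rbar * c - c * d + c * (e * rbar) - e * (c * d)"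
      by (simp add: algebra_simps)
    finally show ?thesis using late' z(3) a_nonneg a_less_b d(4,6) unfolding d(1) by simp
  qed
  ultimately have "flow_hit F B m (y, u) \<le> ereal (rbar * c) \<longleftrightarrow> m \<le> visits R A (nat \<lfloor>c\<rfloor>) y" for m
    using flow_hit_le_iff_visits[OF z(1,2) _ LN] no_visit c rbar_pos by (simp add: L_def H_def)
  from this[of m] this[of "m + 1"] show ?thesis unfolding not_le[symmetric] by auto
qed

text \<open>The two events differ only at irregular points, at high points, and at low points over the target
or over a point with a visit in the window of length about \<open>2 e c\<close>.  Since \<open>c\<close> will be
\<open>t\<close> divided by the measure of the target, the last contribution is about
\<open>2 e t K' / rbar\<close>.\<close>

lemma flow_event_measure_bound:
  assumes box: "roof_box r A a b" and A [measurable]: "A \<in> sets M" and c: "0 < c" and e: "0 < e" "e \<le> 1"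
    and K': "0 \<le> K'"
    and late: "2 * (real K + K' + b) < e * rbar * c"
  shows "\<bar>measure P {z \<in> space P. flow_hit (susp_flow R r) (A \<times> {a..b}) m z \<le> ereal (rbar * c) \<and>
      ereal (rbar * c) < flow_hit (susp_flow R r) (A \<times> {a..b}) (m + 1) z}
     - measure P {z \<in> X. visits R A (nat \<lfloor>c\<rfloor>) (fst z) = m}\<bar>
    \<le> measure P {z \<in> X. fst z \<notin> regular_set r (e * rbar / 4) K} + measure P {z \<in> X. K' < snd z}
      + K' * ((2 * e * c + 3) * measure M A) / rbar"
proof -
  define L H where "L = nat \<lfloor>(1 - e) * c\<rfloor>" and "H = nat \<lceil>(1 + e) * c\<rceil>"
  define E where "E = A \<union> {y \<in> space M. visits R A H y \<noteq> visits R A L y}"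
  define W where "W = {z \<in> space P. flow_hit (susp_flow R r) (A \<times> {a..b}) m z \<le> ereal (rbar * c) \<and>
      ereal (rbar * c) < flow_hit (susp_flow R r) (A \<times> {a..b}) (m + 1) z}"
  define V where "V = {z \<in> X. visits R A (nat \<lfloor>c\<rfloor>) (fst z) = m}"
  define Q1 where "Q1 = {z \<in> X. fst z \<notin> regular_set r (e * rbar / 4) K}"
  define Q2 where "Q2 = {z \<in> X. K' < snd z}"
  define Q3 where "Q3 = {z \<in> X. fst z \<in> E \<and> snd z \<le> K'}"
  have E_sets [measurable]: "E \<in> sets M" unfolding E_def by (intro sets.Un visits_neq_sets A)
  have "W = {z \<in> X. flow_hit (susp_flow R r) (A \<times> {a..b}) m z \<le> ereal (rbar * c)}
     - {z \<in> X. flow_hit (susp_flow R r) (A \<times> {a..b}) (m + 1) z \<le> ereal (rbar * c)}"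
    unfolding W_def space_P not_le[symmetric] by blast
  then have W: "W \<in> sets P" by (simp only:) (intro sets.Diff flow_hit_le_sets box A)
  have V: "V \<in> sets P" unfolding V_def by (rule Collect_sets_P) measurable
  have "Q1 \<in> sets P" unfolding Q1_def by (rule Collect_sets_P) measurable
  moreover have "Q2 \<in> sets P" unfolding Q2_def by (rule Collect_sets_P) measurable
  moreover have "Q3 \<in> sets P" unfolding Q3_def by (rule Collect_sets_P) measurable
  ultimately have Q: "Q1 \<in> sets P" "Q2 \<in> sets P" "Q3 \<in> sets P" .
  have iff: "z \<in> W \<longleftrightarrow> z \<in> V" if "z \<in> X" "z \<notin> Q1 \<union> Q2 \<union> Q3" for z
  proof -
    obtain y u where z: "z = (y, u)" by force
    have "y \<notin> A" "u \<le> K'" "y \<in> regular_set r (e * rbar / 4) K" "visits R A H y = visits R A L y"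
      using that by (auto simp: z Q1_def Q2_def Q3_def E_def space_M)
    with that(1) have event: "flow_hit (susp_flow R r) (A \<times> {a..b}) m z \<le> ereal (rbar * c) \<and>
        ereal (rbar * c) < flow_hit (susp_flow R r) (A \<times> {a..b}) (m + 1) z
      \<longleftrightarrow> visits R A (nat \<lfloor>c\<rfloor>) (fst z) = m"
      unfolding z fst_conv H_def L_def by (intro flow_event_iff[OF box c e _ _ _ _ late])
    show ?thesis
      unfolding W_def V_def space_P mem_Collect_eq event using that(1) by simp
  qed
  have sub: "W \<subseteq> V \<union> (Q1 \<union> Q2 \<union> Q3)" "V \<subseteq> W \<union> (Q1 \<union> Q2 \<union> Q3)"
    using iff unfolding W_def V_def space_P by blast+
  have "measure P (Q1 \<union> Q2 \<union> Q3) \<le> measure P Q1 + measure P Q2 + measure P Q3"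
    using measure_Un_le[OF sets.Un[OF Q(1,2)] Q(3)] measure_Un_le[OF Q(1,2)] by linarith
  moreover have "measure P W \<le> measure P V + measure P (Q1 \<union> Q2 \<union> Q3)"
  proof -
    have "measure P W \<le> measure P (V \<union> (Q1 \<union> Q2 \<union> Q3))"
      using sub(1) V Q by (intro P.finite_measure_mono sets.Un)
    also have "\<dots> \<le> measure P V + measure P (Q1 \<union> Q2 \<union> Q3)"
      using V Q by (intro measure_Un_le sets.Un)
    finally show ?thesis .
  qed
  moreover have "measure P V \<le> measure P W + measure P (Q1 \<union> Q2 \<union> Q3)"
  proof -
    have "measure P V \<le> measure P (W \<union> (Q1 \<union> Q2 \<union> Q3))"
      using sub(2) W Q by (intro P.finite_measure_mono sets.Un)
    also have "\<dots> \<le> measure P W + measure P (Q1 \<union> Q2 \<union> Q3)"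
      using W Q by (intro measure_Un_le sets.Un)
    finally show ?thesis .
  qed
  moreover have "measure P Q3 \<le> K' * ((2 * e * c + 3) * measure M A) / rbar"
  proof -
    have "real L \<le> (1 - e) * c" unfolding L_def using c e by simp
    also have "\<dots> \<le> (1 + e) * c" using c e by (intro mult_right_mono) auto
    also have "\<dots> \<le> real H" unfolding H_def by (rule real_nat_ceiling_ge)
    finally have "L \<le> H" by simp
    then obtain j where j: "H = L + j" by (auto simp: le_iff_add)
    have "measure M E \<le> measure M A + real j * measure M A"
      using measure_visits_window[OF A, of L j] measure_Un_le[OF A visits_neq_sets[OF A], of H L]
      unfolding E_def j by linarith
    also have "\<dots> = (1 + real j) * measure M A" by (simp add: algebra_simps)
    also have "\<dots> \<le> (2 * e * c + 3) * measure M A"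
    proof (rule mult_right_mono)
      have "0 \<le> (1 + e) * c" "0 \<le> (1 - e) * c" using c e by auto
      then have "real H \<le> (1 + e) * c + 1" "(1 - e) * c - 1 \<le> real L" unfolding H_def L_def by linarith+
      moreover have "real H = real L + real j" by (simp add: j)
      ultimately show "1 + real j \<le> 2 * e * c + 3" by (simp add: algebra_simps)
    qed simp
    finally have "K' * measure M E / rbar \<le> K' * ((2 * e * c + 3) * measure M A) / rbar"
      using K' rbar_pos by (intro divide_right_mono mult_left_mono) auto
    then show ?thesis using measure_P_low[OF E_sets K'] unfolding Q3_def by linarith
  qed
  ultimately show ?thesis unfolding W_def V_def Q1_def Q2_def by linarith
qed

lemma regular_set_mono: "K \<le> K' \<Longrightarrow> regular_set f e K \<subseteq> regular_set f e K'"
  unfolding regular_set_def by (auto intro: order_trans)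

text \<open>The constants in the bound above are chosen in the order \<open>K0\<close> (height), then \<open>e\<close> (width
of the window), then \<open>K\<close> (regularity, which depends on \<open>e\<close>), and finally the target is
taken small.\<close>

lemma flow_law_tendsto:
  fixes A :: "'i \<Rightarrow> 'a set" and a b :: "'i \<Rightarrow> real"
  assumes A: "\<And>i. A i \<in> sets M"
    and box: "\<forall>\<^sub>F i in F. roof_box r (A i) (a i) (b i)" and bounded: "\<forall>\<^sub>F i in F. b i \<le> \<beta>"
    and pos: "\<forall>\<^sub>F i in F. 0 < measure M (A i)"
    and small: "((\<lambda>i. measure M (A i)) \<longlongrightarrow> 0) F"
    and t: "0 < t"
    and law: "((\<lambda>i. measure M {y \<in> space M. visits R (A i) (nat \<lfloor>t / measure M (A i)\<rfloor>) y = m}) \<longlongrightarrow> p) F"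
  shows "((\<lambda>i. measure P {z \<in> space P.
        flow_hit (susp_flow R r) (A i \<times> {a i..b i}) m z \<le> ereal (rbar * (t / measure M (A i)))
        \<and> ereal (rbar * (t / measure M (A i))) < flow_hit (susp_flow R r) (A i \<times> {a i..b i}) (m + 1) z})
      \<longlongrightarrow> p) F"
proof -
  let ?c = "\<lambda>i. t / measure M (A i)"
  let ?V = "\<lambda>i. measure P {z \<in> X. visits R (A i) (nat \<lfloor>?c i\<rfloor>) (fst z) = m}"
  let ?W = "\<lambda>i. measure P {z \<in> space P.
        flow_hit (susp_flow R r) (A i \<times> {a i..b i}) m z \<le> ereal (rbar * ?c i)
        \<and> ereal (rbar * ?c i) < flow_hit (susp_flow R r) (A i \<times> {a i..b i}) (m + 1) z}"
  have "((\<lambda>i. ?W i - ?V i) \<longlongrightarrow> 0) F"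
  proof (rule tendstoI)
    fix \<eta> :: real assume "0 < \<eta>"
    have "\<exists>K. measure P (space P - {z \<in> X. snd z \<le> real K}) < \<eta> / 4"
    proof (rule P.exhausting_events)
      show "{z \<in> X. snd z \<le> real K} \<in> sets P" for K by (rule Collect_sets_P) measurable
      show "AE z in P. \<exists>K. z \<in> {z \<in> X. snd z \<le> real K}"
        by (rule AE_I2) (auto simp: space_P real_arch_simple)
    qed (use \<open>0 < \<eta>\<close> in \<open>auto simp: incseq_def\<close>)
    then obtain K0 :: nat where "measure P (space P - {z \<in> X. snd z \<le> real K0}) < \<eta> / 4" by blast
    moreover have "space P - {z \<in> X. snd z \<le> real K0} = {z \<in> X. real K0 < snd z}"
      by (auto simp: space_P)
    ultimately have K0: "measure P {z \<in> X. real K0 < snd z} < \<eta> / 4" by simp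
    \<comment> \<open>chosen such that the contribution of the window, \<open>2 e t K0 / rbar\<close>, is at most a quarter of \<open>\<eta>\<close>\<close>
    define e where "e = min 1 (\<eta> * rbar / (8 * (real K0 + 1) * t))"
    have e: "0 < e" "e \<le> 1" using \<open>0 < \<eta>\<close> rbar_pos t by (auto simp: e_def)
    have "e * (8 * (real K0 + 1) * t) \<le> \<eta> * rbar / (8 * (real K0 + 1) * t) * (8 * (real K0 + 1) * t)"
      using t by (intro mult_right_mono) (auto simp: e_def)
    also have "\<dots> = \<eta> * rbar" using t by simp
    finally have "e * (8 * (real K0 + 1) * t) \<le> \<eta> * rbar" .
    moreover have "0 < e * t" using e t by simp
    ultimately have "real K0 * (2 * e * t) \<le> \<eta> / 4 * rbar" by (simp add: algebra_simps)
    then have e_small: "real K0 * (2 * e * t) / rbar \<le> \<eta> / 4" using rbar_pos by (simp add: field_simps)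
    let ?G = "\<lambda>K. {z \<in> X. fst z \<in> regular_set r (e * rbar / 4) K}"
    have "\<exists>K. measure P (space P - ?G K) < \<eta> / 4"
    proof (rule P.exhausting_events)
      show "?G K \<in> sets P" for K by (rule Collect_sets_P) measurable
      show "incseq ?G" using regular_set_mono unfolding incseq_def by blast
      have "AE z in P. \<exists>K. fst z \<in> regular_set r (e * rbar / 4) K"
        using e rbar_pos by (intro AE_P_fst AE_regular_set r_integrable) auto
      then show "AE z in P. \<exists>K. z \<in> ?G K"
        using AE_space by eventually_elim (auto simp: space_P)
    qed (use \<open>0 < \<eta>\<close> in simp)
    then obtain K where "measure P (space P - ?G K) < \<eta> / 4" by blast
    moreover have "space P - ?G K = {z \<in> X. fst z \<notin> regular_set r (e * rbar / 4) K}"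
      by (auto simp: space_P)
    ultimately have K: "measure P {z \<in> X. fst z \<notin> regular_set r (e * rbar / 4) K} < \<eta> / 4" by simp
    define \<kappa> where "\<kappa> = 2 * (real K + real K0 + \<bar>\<beta>\<bar>) + 1"
    have \<kappa>: "0 < \<kappa>" by (simp add: \<kappa>_def)
    have "\<forall>\<^sub>F i in F. measure M (A i) < e * rbar * t / \<kappa>"
      using small e rbar_pos t \<kappa> by (intro order_tendstoD(2)) auto
    moreover have "\<forall>\<^sub>F i in F. measure M (A i) < \<eta> * rbar / (12 * (real K0 + 1))"
      using small \<open>0 < \<eta>\<close> rbar_pos by (intro order_tendstoD(2)) auto
    ultimately show "\<forall>\<^sub>F i in F. dist (?W i - ?V i) 0 < \<eta>"
      using box bounded pos
    proof eventually_elim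
      case (elim i)
      let ?\<mu> = "measure M (A i)"
      have c: "0 < ?c i" "?c i * ?\<mu> = t" using elim(5) t by auto
      have "\<kappa> < e * rbar * ?c i" using elim(1,5) \<kappa> by (simp add: field_simps)
      moreover have "2 * (real K + real K0 + b i) < \<kappa>"
        using elim(4) abs_ge_self[of \<beta>] unfolding \<kappa>_def by argo
      ultimately have late: "2 * (real K + real K0 + b i) < e * rbar * ?c i" by (rule less_trans[rotated])
      have "\<bar>?W i - ?V i\<bar> \<le> measure P {z \<in> X. fst z \<notin> regular_set r (e * rbar / 4) K}
          + measure P {z \<in> X. real K0 < snd z} + real K0 * ((2 * e * ?c i + 3) * ?\<mu>) / rbar"
        by (rule flow_event_measure_bound[OF elim(3) A c(1) e _ late]) simp
      moreover have "real K0 * ((2 * e * ?c i + 3) * ?\<mu>) / rbar =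
          real K0 * (2 * e * t) / rbar + 3 * (real K0 * ?\<mu>) / rbar"
      proof -
        have "(2 * e * ?c i + 3) * ?\<mu> = 2 * e * (?c i * ?\<mu>) + 3 * ?\<mu>"
          by (simp only: distrib_right mult.assoc)
        then have "(2 * e * ?c i + 3) * ?\<mu> = 2 * e * t + 3 * ?\<mu>" unfolding c(2) .
        then show ?thesis by (simp only: distrib_left add_divide_distrib mult.left_commute)
      qed
      moreover have "3 * (real K0 * ?\<mu>) / rbar \<le> \<eta> / 4"
      proof -
        have "12 * (real K0 + 1) * ?\<mu> < \<eta> * rbar" using elim(2) by (simp add: field_simps)
        then have "12 * (real K0 * ?\<mu>) \<le> \<eta> * rbar" using elim(5) by (simp add: algebra_simps)
        then show ?thesis using rbar_pos by (simp add: field_simps)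
      qed
      ultimately show ?case using K K0 e_small by (simp add: dist_real_def)
    qed
  qed
  moreover have "((\<lambda>i. ?V i - measure M {y \<in> space M. visits R (A i) (nat \<lfloor>?c i\<rfloor>) y = m}) \<longlongrightarrow> 0) F"
    by (rule visits_law_transfer[OF A small])
  ultimately have "((\<lambda>i. (?W i - ?V i)
      + (?V i - measure M {y \<in> space M. visits R (A i) (nat \<lfloor>?c i\<rfloor>) y = m})
      + measure M {y \<in> space M. visits R (A i) (nat \<lfloor>?c i\<rfloor>) y = m}) \<longlongrightarrow> 0 + 0 + p) F"
    using law by (intro tendsto_add)
  then show ?thesis by simp
qed

end

section \<open>Shrinking balls\<close>

text \<open>At an interior point of the phase space small closed balls of the box metric are full boxes, which
stay below the roof and above the base.\<close>

lemma box_cball_eq_product: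
  fixes x :: "'a::metric_space"
  assumes "(x, s) \<in> interior (susp_space r)" and r_pos: "\<And>y. 0 < r y"
  shows "\<forall>\<^sub>F \<rho> in at_right 0. roof_box r (cball x \<rho>) (s - \<rho>) (s + \<rho>)
    \<and> box_cball r (x, s) \<rho> = cball x \<rho> \<times> {s - \<rho>..s + \<rho>}"
proof -
  obtain T where T: "open T" "(x, s) \<in> T" "T \<subseteq> susp_space r"
    using assms(1) by (rule interiorE)
  then obtain U V where UV: "open U" "open V" "x \<in> U" "s \<in> V" "U \<times> V \<subseteq> T"
    by (auto elim: open_prod_elim)
  obtain d where d: "0 < d" "cball x d \<subseteq> U" using UV open_contains_cball by blast
  obtain d' where d': "0 < d'" "cball s d' \<subseteq> V" using UV open_contains_cball by blast
  have "\<forall>\<^sub>F \<rho> in at_right (0::real). \<rho> < min d d'" "\<forall>\<^sub>F \<rho> in at_right (0::real). 0 < \<rho>"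
    using d d' by (auto intro: eventually_at_right_less eventually_at_rightI[of 0 "min d d'"])
  then show ?thesis
  proof eventually_elim
    case (elim \<rho>)
    have in_susp: "(y, v) \<in> susp_space r" if "dist x y \<le> d" "\<bar>v - s\<bar> \<le> d'" for y v
    proof -
      have "y \<in> U" "v \<in> V" using that d(2) d'(2) by (auto simp: dist_real_def)
      then show ?thesis using UV(5) T(3) by blast
    qed
    have "roof_box r (cball x \<rho>) (s - \<rho>) (s + \<rho>)"
    proof
      show "0 \<le> s - \<rho>" using in_susp[of x "s - \<rho>"] elim d by (simp add: susp_space_def)
      show "s + \<rho> < r y" if "y \<in> cball x \<rho>" for y
        using in_susp[of y "s + \<rho>"] elim that by (simp add: susp_space_def)
    qed (use elim r_pos in auto)
    moreover have "box_cball r (x, s) \<rho> = cball x \<rho> \<times> {s - \<rho>..s + \<rho>}"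
    proof (rule set_eqI)
      fix z :: "'a \<times> real"
      obtain y v where z: "z = (y, v)" by force
      show "z \<in> box_cball r (x, s) \<rho> \<longleftrightarrow> z \<in> cball x \<rho> \<times> {s - \<rho>..s + \<rho>}"
        using in_susp[of y v] elim unfolding z by (auto simp: box_cball_def box_dist_def abs_le_iff)
    qed
    ultimately show ?case by blast
  qed
qed

text \<open>The assumed law itself forces the measure of the balls to be positive and to tend to \<open>0\<close>:
otherwise the rescaled time, which is \<open>0\<close> for a ball of measure \<open>0\<close>, would stay below
\<open>1\<close> for some \<open>t\<close>, so that there would be no
visit at all up to that time and the limit would be \<open>0\<close> or the total mass.\<close>

lemma balls_shrink_of_law:
  fixes x :: "'a::metric_space"
  assumes "finite_measure M" and sets: "sets M = sets borel"
    and p: "\<And>t. 0 < t \<Longrightarrow> p t \<noteq> measure M {y \<in> space M. 0 = m}"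
    and law: "\<And>t. 0 < t \<Longrightarrow> ((\<lambda>\<rho>. measure M {y \<in> space M.
        visits R (cball x \<rho>) (nat \<lfloor>t / measure M (cball x \<rho>)\<rfloor>) y = m}) \<longlongrightarrow> p t) (at_right 0)"
  shows "\<forall>\<^sub>F \<rho> in at_right 0. 0 < measure M (cball x \<rho>)"
    and "((\<lambda>\<rho>. measure M (cball x \<rho>)) \<longlongrightarrow> 0) (at_right 0)"
proof -
  interpret finite_measure M by fact
  have no_bound: False if t: "0 < t" and ev: "\<forall>\<^sub>F \<rho> in at_right 0. nat \<lfloor>t / measure M (cball x \<rho>)\<rfloor> = 0" for t
  proof -
    have "((\<lambda>\<rho>. measure M {y \<in> space M.
        visits R (cball x \<rho>) (nat \<lfloor>t / measure M (cball x \<rho>)\<rfloor>) y = m}) \<longlongrightarrow> measure M {y \<in> space M. 0 = m}) (at_right 0)"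
      by (rule tendsto_eventually) (use ev in eventually_elim, simp)
    then show False using tendsto_unique[OF _ law[OF t]] p[OF t] by force
  qed
  have mono: "measure M (cball x \<rho>) \<le> measure M (cball x \<rho>')" if "\<rho> \<le> \<rho>'" for \<rho> \<rho>'
    using that by (intro finite_measure_mono) (auto simp: sets)
  have near_0: "\<forall>\<^sub>F \<rho> in at_right 0. \<rho> < \<rho>'" "\<forall>\<^sub>F \<rho> in at_right (0::real). 0 < \<rho>" if "0 < \<rho>'" for \<rho>' :: real
    using that by (auto intro: eventually_at_rightI[of 0 \<rho>'] eventually_at_right_less)
  have "0 < measure M (cball x \<rho>')" if "0 < \<rho>'" for \<rho>'
  proof (rule ccontr)
    assume "\<not> 0 < measure M (cball x \<rho>')"
    then have zero: "measure M (cball x \<rho>) = 0" if "\<rho> < \<rho>'" for \<rho>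
      using mono[of \<rho> \<rho>'] that measure_nonneg[of M] by (simp add: order.antisym)
    have "\<forall>\<^sub>F \<rho> in at_right 0. nat \<lfloor>1 / measure M (cball x \<rho>)\<rfloor> = 0"
      using near_0(1)[OF that] by eventually_elim (simp add: zero)
    then show False using no_bound[of 1] by simp
  qed
  then show "\<forall>\<^sub>F \<rho> in at_right 0. 0 < measure M (cball x \<rho>)"
    using near_0(2)[of 1] by (auto elim: eventually_mono)
  show "((\<lambda>\<rho>. measure M (cball x \<rho>)) \<longlongrightarrow> 0) (at_right 0)"
  proof (rule order_tendstoI)
    fix \<epsilon> :: real assume \<epsilon>: "0 < \<epsilon>"
    have "\<exists>\<rho>'>0. measure M (cball x \<rho>') < \<epsilon>"
    proof (rule ccontr)
      assume "\<not> ?thesis"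
      then have ge: "\<epsilon> \<le> measure M (cball x \<rho>)" if "0 < \<rho>" for \<rho>
        using that by (meson not_less)
      have "\<forall>\<^sub>F \<rho> in at_right 0. nat \<lfloor>(\<epsilon> / 2) / measure M (cball x \<rho>)\<rfloor> = 0"
        using near_0(2)[of 1, OF zero_less_one]
      proof eventually_elim
        case (elim \<rho>)
        have "(\<epsilon> / 2) / measure M (cball x \<rho>) < 1"
          using ge[OF elim] \<epsilon> by (simp add: divide_less_eq)
        then show ?case by (simp add: floor_less_iff)
      qed
      then show False using no_bound[of "\<epsilon> / 2"] \<epsilon> by simp
    qed
    then obtain \<rho>' where \<rho>': "0 < \<rho>'" "measure M (cball x \<rho>') < \<epsilon>" by blast
    show "\<forall>\<^sub>F \<rho> in at_right 0. measure M (cball x \<rho>) < \<epsilon>"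
      using near_0(1)[OF \<rho>'(1)]
    proof eventually_elim
      case (elim \<rho>)
      then show ?case using mono[of \<rho> \<rho>'] \<rho>'(2) by simp
    qed
  next
    fix \<epsilon> :: real assume "\<epsilon> < 0"
    then show "\<forall>\<^sub>F \<rho> in at_right 0. \<epsilon> < measure M (cball x \<rho>)"
      by (intro always_eventually allI less_le_trans[OF _ measure_nonneg])
  qed
qed

context suspension begin

text \<open>The box has fibres of length \<open>2 \<rho>\<close>, so the time scale of the flow, \<open>2 \<rho>\<close> divided by the
measure of the box, is \<open>rbar\<close> times the time scale of the map.\<close>

lemma flow_law_of_map_law:
  fixes A :: "real \<Rightarrow> 'a set" and C :: "real \<Rightarrow> ('a \<times> real) set"
  assumes A: "\<And>\<rho>. A \<rho> \<in> sets M"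
    and box: "\<forall>\<^sub>F \<rho> in at_right 0. roof_box r (A \<rho>) (s - \<rho>) (s + \<rho>) \<and> C \<rho> = A \<rho> \<times> {s - \<rho>..s + \<rho>}"
    and pos: "\<forall>\<^sub>F \<rho> in at_right 0. 0 < measure M (A \<rho>)"
    and small: "((\<lambda>\<rho>. measure M (A \<rho>)) \<longlongrightarrow> 0) (at_right 0)"
    and t: "0 < t"
    and law: "((\<lambda>\<rho>. measure M {y \<in> space M. visits R (A \<rho>) (nat \<lfloor>t / measure M (A \<rho>)\<rfloor>) y = m}) \<longlongrightarrow> p) (at_right 0)"
  shows "((\<lambda>\<rho>. measure P {z \<in> space P.
        flow_hit (susp_flow R r) (C \<rho>) m z \<le> ereal (t * (2 * \<rho>) / measure P (C \<rho>))
        \<and> ereal (t * (2 * \<rho>) / measure P (C \<rho>)) < flow_hit (susp_flow R r) (C \<rho>) (m + 1) z})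
      \<longlongrightarrow> p) (at_right 0)"
proof -
  have bounded: "\<forall>\<^sub>F \<rho> in at_right 0. s + \<rho> \<le> s + 1"
    by (rule eventually_at_rightI[of 0 1]) auto
  have "\<forall>\<^sub>F \<rho> in at_right 0. roof_box r (A \<rho>) (s - \<rho>) (s + \<rho>)"
    using box by (auto elim: eventually_mono)
  from flow_law_tendsto[OF A this bounded pos small t law]
  show ?thesis
  proof (rule Lim_transform_eventually)
    show "\<forall>\<^sub>F \<rho> in at_right 0. measure P {z \<in> space P.
        flow_hit (susp_flow R r) (A \<rho> \<times> {s - \<rho>..s + \<rho>}) m z \<le> ereal (rbar * (t / measure M (A \<rho>)))
        \<and> ereal (rbar * (t / measure M (A \<rho>))) < flow_hit (susp_flow R r) (A \<rho> \<times> {s - \<rho>..s + \<rho>}) (m + 1) z}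
      = measure P {z \<in> space P.
        flow_hit (susp_flow R r) (C \<rho>) m z \<le> ereal (t * (2 * \<rho>) / measure P (C \<rho>))
        \<and> ereal (t * (2 * \<rho>) / measure P (C \<rho>)) < flow_hit (susp_flow R r) (C \<rho>) (m + 1) z}"
      using box pos eventually_at_right_less[of "0::real"]
    proof eventually_elim
      case (elim \<rho>)
      interpret roof_box R r "A \<rho>" "s - \<rho>" "s + \<rho>" using elim(1) by blast
      have "measure P (C \<rho>) = 2 * \<rho> * measure M (A \<rho>) / rbar"
        using elim measure_P_box[OF A box_subset] by simp
      then have "t * (2 * \<rho>) / measure P (C \<rho>) = rbar * (t / measure M (A \<rho>))"
        using elim rbar_pos by simp
      then show ?case using elim(1) by simp
    qed
  qed
qed

end

theorem theorem1:
  fixes M :: "'a::metric_space measure"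
    and R :: "'a \<Rightarrow> 'a"
    and r :: "'a \<Rightarrow> real"
    and x :: 'a and s :: real
  assumes "prob_space M"
    and "sets M = sets borel"
    and "R \<in> measurable M M"
    and "distr M M R = M"
    and "ergodic_on M R"
    and "\<And>y. 0 < r y"
    and "integrable M r"
    and "(x, s) \<in> interior (susp_space r)"
  shows
    "((\<forall>t>0. ((\<lambda>\<rho>. measure M {y \<in> space M.
                ereal_of_enat (map_hit R (cball x \<rho>) 1 y) > ereal (t / measure M (cball x \<rho>))})
              \<longlongrightarrow> exp (- t)) (at_right 0))
      \<longrightarrow>
      (\<forall>t>0. ((\<lambda>\<rho>. measure (susp_measure M r) {z \<in> space (susp_measure M r).
                flow_hit (susp_flow R r) (box_cball r (x, s) \<rho>) 1 z
                  > ereal (t * (2 * \<rho>) / measure (susp_measure M r) (box_cball r (x, s) \<rho>))})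
              \<longlongrightarrow> exp (- t)) (at_right 0)))
     \<and>
     ((\<forall>t>0. \<forall>m\<ge>1. ((\<lambda>\<rho>. measure M {y \<in> space M.
                ereal_of_enat (map_hit R (cball x \<rho>) m y) \<le> ereal (t / measure M (cball x \<rho>))
                \<and> ereal (t / measure M (cball x \<rho>))
                    < ereal_of_enat (map_hit R (cball x \<rho>) (m + 1) y)})
              \<longlongrightarrow> exp (- t) * t ^ m / fact m) (at_right 0))
      \<longrightarrow>
      (\<forall>t>0. \<forall>m\<ge>1. ((\<lambda>\<rho>. measure (susp_measure M r) {z \<in> space (susp_measure M r).
                flow_hit (susp_flow R r) (box_cball r (x, s) \<rho>) m z
                  \<le> ereal (t * (2 * \<rho>) / measure (susp_measure M r) (box_cball r (x, s) \<rho>))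
                \<and> ereal (t * (2 * \<rho>) / measure (susp_measure M r) (box_cball r (x, s) \<rho>))
                  < flow_hit (susp_flow R r) (box_cball r (x, s) \<rho>) (m + 1) z})
              \<longlongrightarrow> exp (- t) * t ^ m / fact m) (at_right 0)))"
proof -
  have space_M: "space M = UNIV" using sets_eq_imp_space_eq[OF assms(2)] by simp
  interpret prob_space M by fact
  interpret suspension M R r
    by unfold_locales (use assms(3-7) space_M in \<open>simp_all only:\<close>)
  have map_event: "{y \<in> space M. ereal_of_enat (map_hit R (cball x \<rho>) m y) \<le> ereal (t / measure M (cball x \<rho>))
        \<and> ereal (t / measure M (cball x \<rho>)) < ereal_of_enat (map_hit R (cball x \<rho>) (m + 1) y)}
      = {y \<in> space M. visits R (cball x \<rho>) (nat \<lfloor>t / measure M (cball x \<rho>)\<rfloor>) y = m}" if "0 < t" for t m \<rho>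
    using that by (subst map_hit_between_iff) auto
  have transfer: "((\<lambda>\<rho>. measure P {z \<in> space P.
        flow_hit (susp_flow R r) (box_cball r (x, s) \<rho>) m z \<le> ereal (t * (2 * \<rho>) / measure P (box_cball r (x, s) \<rho>))
        \<and> ereal (t * (2 * \<rho>) / measure P (box_cball r (x, s) \<rho>)) < flow_hit (susp_flow R r) (box_cball r (x, s) \<rho>) (m + 1) z})
      \<longlongrightarrow> p t) (at_right 0)"
    if law: "\<And>t. 0 < t \<Longrightarrow> ((\<lambda>\<rho>. measure M {y \<in> space M.
          ereal_of_enat (map_hit R (cball x \<rho>) m y) \<le> ereal (t / measure M (cball x \<rho>))
          \<and> ereal (t / measure M (cball x \<rho>)) < ereal_of_enat (map_hit R (cball x \<rho>) (m + 1) y)}) \<longlongrightarrow> p t) (at_right 0)"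
      and p: "\<And>t. 0 < t \<Longrightarrow> p t \<noteq> of_bool (m = 0)" and t: "0 < t" for p m t
  proof -
    have law': "((\<lambda>\<rho>. measure M {y \<in> space M.
        visits R (cball x \<rho>) (nat \<lfloor>t / measure M (cball x \<rho>)\<rfloor>) y = m}) \<longlongrightarrow> p t) (at_right 0)" if "0 < t" for t
      using law[OF that] unfolding map_event[OF that] .
    have "measure M {y \<in> space M. 0 = m} = of_bool (m = 0)" by (simp add: prob_space)
    with p have p': "p t \<noteq> measure M {y \<in> space M. 0 = m}" if "0 < t" for t using that by simp
    note shrink = balls_shrink_of_law[OF finite_measure_axioms assms(2) p' law']
    show ?thesis
      by (rule flow_law_of_map_law[OF _ box_cball_eq_product[OF assms(8,6)] shrink t law'[OF t]])
        (simp_all add: assms(2))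
  qed
  show ?thesis
  proof (intro conjI impI allI)
    fix t :: real
    assume law: "\<forall>t>0. ((\<lambda>\<rho>. measure M {y \<in> space M.
                ereal_of_enat (map_hit R (cball x \<rho>) 1 y) > ereal (t / measure M (cball x \<rho>))})
              \<longlongrightarrow> exp (- t)) (at_right 0)" and t: "0 < t"
    \<comment> \<open>the first hitting time is the case \<open>m = 0\<close>, in which the lower bound is void\<close>
    have "((\<lambda>\<rho>. measure M {y \<in> space M.
          ereal_of_enat (map_hit R (cball x \<rho>) 0 y) \<le> ereal (t / measure M (cball x \<rho>))
          \<and> ereal (t / measure M (cball x \<rho>)) < ereal_of_enat (map_hit R (cball x \<rho>) (0 + 1) y)})
        \<longlongrightarrow> exp (- t)) (at_right 0)" if "0 < t" for t
    proof -
      have "ereal_of_enat (map_hit R (cball x \<rho>) 0 y) \<le> ereal (t / measure M (cball x \<rho>))" for \<rho> y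
        using that by (simp add: zero_ereal_def[symmetric])
      then show ?thesis using law that by (simp only: simp_thms add_0)
    qed
    moreover have "exp (- t) \<noteq> of_bool ((0::nat) = 0)" if "0 < t" for t :: real using that by simp
    ultimately have "((\<lambda>\<rho>. measure P {z \<in> space P.
        flow_hit (susp_flow R r) (box_cball r (x, s) \<rho>) 0 z \<le> ereal (t * (2 * \<rho>) / measure P (box_cball r (x, s) \<rho>))
        \<and> ereal (t * (2 * \<rho>) / measure P (box_cball r (x, s) \<rho>)) < flow_hit (susp_flow R r) (box_cball r (x, s) \<rho>) (0 + 1) z})
      \<longlongrightarrow> exp (- t)) (at_right 0)"
      by (rule transfer[of 0 "\<lambda>t. exp (- t)" t, OF _ _ t])
    then show "((\<lambda>\<rho>. measure (susp_measure M r) {z \<in> space (susp_measure M r).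
                flow_hit (susp_flow R r) (box_cball r (x, s) \<rho>) 1 z
                  > ereal (t * (2 * \<rho>) / measure (susp_measure M r) (box_cball r (x, s) \<rho>))})
              \<longlongrightarrow> exp (- t)) (at_right 0)"
    proof (rule Lim_transform_eventually)
      show "\<forall>\<^sub>F \<rho> in at_right 0. measure P {z \<in> space P.
        flow_hit (susp_flow R r) (box_cball r (x, s) \<rho>) 0 z \<le> ereal (t * (2 * \<rho>) / measure P (box_cball r (x, s) \<rho>))
        \<and> ereal (t * (2 * \<rho>) / measure P (box_cball r (x, s) \<rho>)) < flow_hit (susp_flow R r) (box_cball r (x, s) \<rho>) (0 + 1) z}
        = measure P {z \<in> space P. flow_hit (susp_flow R r) (box_cball r (x, s) \<rho>) 1 z
                  > ereal (t * (2 * \<rho>) / measure P (box_cball r (x, s) \<rho>))}"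
        using eventually_at_right_less[of "0::real"]
      proof eventually_elim
        case (elim \<rho>)
        then have "(0::ereal) \<le> ereal (t * (2 * \<rho>) / measure P (box_cball r (x, s) \<rho>))" using t by simp
        then show ?case unfolding flow_hit.simps(1) by (simp only: simp_thms add_0)
      qed
    qed
  next
    fix t :: real and m :: nat
    assume law: "\<forall>t>0. \<forall>m\<ge>1. ((\<lambda>\<rho>. measure M {y \<in> space M.
                ereal_of_enat (map_hit R (cball x \<rho>) m y) \<le> ereal (t / measure M (cball x \<rho>))
                \<and> ereal (t / measure M (cball x \<rho>))
                    < ereal_of_enat (map_hit R (cball x \<rho>) (m + 1) y)})
              \<longlongrightarrow> exp (- t) * t ^ m / fact m) (at_right 0)" and t: "0 < t" and m: "1 \<le> m"
    show "((\<lambda>\<rho>. measure (susp_measure M r) {z \<in> space (susp_measure M r).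
                flow_hit (susp_flow R r) (box_cball r (x, s) \<rho>) m z
                  \<le> ereal (t * (2 * \<rho>) / measure (susp_measure M r) (box_cball r (x, s) \<rho>))
                \<and> ereal (t * (2 * \<rho>) / measure (susp_measure M r) (box_cball r (x, s) \<rho>))
                  < flow_hit (susp_flow R r) (box_cball r (x, s) \<rho>) (m + 1) z})
              \<longlongrightarrow> exp (- t) * t ^ m / fact m) (at_right 0)"
    proof (intro transfer[of m "\<lambda>t. exp (- t) * t ^ m / fact m" t])
      show "exp (- t) * t ^ m / fact m \<noteq> of_bool (m = 0)" if "0 < t" for t :: real
        using that m by simp
    qed (use law t m in blast)+
  qed
qed

end
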